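(* Let $R=K[x_1,\dots,x_n]$ be the standard graded polynomial ring over a field $K$, let $k\ge 1$, and let $I\subseteq(x_1,\dots,x_n)$ be a homogeneous Gorenstein ideal (i.e. $S=R/I$ is Gorenstein) of grade $s=2k+1$. Write the minimal graded free resolution of $S$ over $R$ as $$0\to R(-c)\to\bigoplus_{j=1}^{b_1}R(-(c-a_{1j}))\to\cdots\to\bigoplus_{j=1}^{b_k}R(-(c-a_{kj}))\to\bigoplus_{j=1}^{b_k}R(-a_{kj})\to\cdots\to\bigoplus_{j=1}^{b_1}R(-a_{1j})\to R .$$ Then for every $l\ge 0$ the $l$-th Hilbert coefficient $e_l$ of $S$ satisfies $$(-1)^k(s+l)!\,e_l=\sum_{r=0}^{l}(-1)^{l-r}\nu_{l-r}\sum_{t=0}^{\lfloor r/2\rfloor}(-1)^t\binom{k+r-t}{k+t}c^{\,r-2t}\sum_{i=1}^k\sum_{j=1}^{b_i}(-1)^i a_{ij}^{k+t}(c-a_{ij})^{k+t}(c-2a_{ij}).$$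
   Context: Hilbert coefficients: let $d=\dim S=n-s$. The Hilbert series of $S$ has the form $\sum_{i\ge0}\dim_K(S_i)t^i=Q(t)/(1-t)^d$ with $Q$ a polynomial, and $e_l=e_l(S)=Q^{(l)}(1)/l!$. For $0\le r\le l$, $$\nu_{l-r}=\sum_{1\le \xi_1<\xi_2<\cdots<\xi_{l-r}\le s+l-1}\xi_1\xi_2\cdots\xi_{l-r},\qquad \nu_0=1,$$ i.e. $\nu_{l-r}$ is the elementary symmetric polynomial of degree $l-r$ evaluated at $1,2,\dots,s+l-1$. Because $S$ is Gorenstein, its minimal resolution is self-dual and hence can be written in the displayed symmetric form. Convention: $\binom{n}{p}=0$ if $n<p$, for nonnegative integers $n,p$. *)

theory Defs
  imports
    "HOL-Library.Poly_Mapping"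
    "HOL-Library.Extended_Nat"
    "HOL-Library.Cardinality"
    "HOL-Computational_Algebra.Polynomial_FPS"
    "HOL-Algebra.Algebraic_Closure_Type"
    "HOL-Algebra.QuotRing"
    "HOL-Algebra.Ring_Divisibility"
    "HOL-Algebra.Embedded_Algebras"
    "Jordan_Normal_Form.Matrix_Kernel"
begin

section \<open>Gorenstein rings\<close>

definition mod_hom ::
    "('a, 'm) ring_scheme \<Rightarrow> ('a, 'b, 'p) module_scheme \<Rightarrow> ('a, 'c, 'q) module_scheme \<Rightarrow> ('b \<Rightarrow> 'c) set" where
  "mod_hom A M N = {f. f \<in> carrier M \<rightarrow> carrier N \<and>
     (\<forall>x\<in>carrier M. \<forall>y\<in>carrier M. f (x \<oplus>\<^bsub>M\<^esub> y) = f x \<oplus>\<^bsub>N\<^esub> f y) \<and>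
     (\<forall>r\<in>carrier A. \<forall>x\<in>carrier M. f (r \<odot>\<^bsub>M\<^esub> x) = r \<odot>\<^bsub>N\<^esub> f x)}"

definition mod_ker :: "('a, 'b, 'p) module_scheme \<Rightarrow> ('a, 'c, 'q) module_scheme \<Rightarrow> ('b \<Rightarrow> 'c) \<Rightarrow> 'b set" where
  "mod_ker M N f = {x \<in> carrier M. f x = \<zero>\<^bsub>N\<^esub>}"

definition self_module :: "('a, 'm) ring_scheme \<Rightarrow> ('a, 'a) module" where
  "self_module A = \<lparr>carrier = carrier A, monoid.mult = monoid.mult A, one = \<one>\<^bsub>A\<^esub>,
     ring.zero = \<zero>\<^bsub>A\<^esub>, add = add A, module.smult = monoid.mult A\<rparr>"

text \<open>
  The test modules M and N live on the element type of A.  This loses no generality: by Baer's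
  criterion it is enough to test the inclusions of the ideals of A into A.
\<close>
definition injective_module :: "('a, 'm) ring_scheme \<Rightarrow> ('a, 'a) module \<Rightarrow> bool" where
  "injective_module A E \<longleftrightarrow> Module.module A E \<and>
     (\<forall>(M :: ('a, 'a) module) (N :: ('a, 'a) module) f g.
        Module.module A M \<and> Module.module A N \<and> f \<in> mod_hom A M N \<and> inj_on f (carrier M) \<and> g \<in> mod_hom A M E \<longrightarrow>
        (\<exists>h\<in>mod_hom A N E. \<forall>x\<in>carrier M. h (f x) = g x))"

text \<open>
  There is a finite injective resolution of A as a module over itself; it is padded by zero modules
  beyond position d.  The modules in the resolution live on the element type of A as well.  For
  noetherian A this loses no generality: if A is infinite, the modules in a minimal injective
  resolution of A have cardinality at most that of A; if A is finite, it is artinian, and finite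
  injective dimension forces A to be injective over itself.
\<close>
definition finite_self_injective_dimension :: "('a, 'm) ring_scheme \<Rightarrow> bool" where
  "finite_self_injective_dimension A \<longleftrightarrow>
     (\<exists>d (E :: nat \<Rightarrow> ('a, 'a) module) \<epsilon> \<delta>.
        (\<forall>i. injective_module A (E i)) \<and>
        \<epsilon> \<in> mod_hom A (self_module A) (E 0) \<and> inj_on \<epsilon> (carrier A) \<and>
        (\<forall>i. \<delta> i \<in> mod_hom A (E i) (E (Suc i))) \<and>
        \<epsilon> ` carrier A = mod_ker (E 0) (E 1) (\<delta> 0) \<and>
        (\<forall>i. \<delta> i ` carrier (E i) = mod_ker (E (Suc i)) (E (Suc (Suc i))) (\<delta> (Suc i))) \<and>
        (\<forall>i>d. carrier (E i) = {\<zero>\<^bsub>E i\<^esub>}))"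

definition frac_rel :: "('a, 'm) ring_scheme \<Rightarrow> 'a set \<Rightarrow> (('a \<times> 'a) \<times> ('a \<times> 'a)) set" where
  "frac_rel A P = {((a, u), (b, v)). a \<in> carrier A \<and> b \<in> carrier A \<and>
     u \<in> carrier A - P \<and> v \<in> carrier A - P \<and>
     (\<exists>w\<in>carrier A - P. w \<otimes>\<^bsub>A\<^esub> (a \<otimes>\<^bsub>A\<^esub> v) = w \<otimes>\<^bsub>A\<^esub> (b \<otimes>\<^bsub>A\<^esub> u))}"

text \<open>The localization of A at the prime ideal P; a fraction a/u is the class of the pair (a, u).\<close>
definition localization :: "('a, 'm) ring_scheme \<Rightarrow> 'a set \<Rightarrow> ('a \<times> 'a) set ring" where
  "localization A P = \<lparr>
     carrier = (carrier A \<times> (carrier A - P)) // frac_rel A P,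
     monoid.mult = (\<lambda>U V. \<Union>(a, u)\<in>U. \<Union>(b, v)\<in>V. frac_rel A P `` {(a \<otimes>\<^bsub>A\<^esub> b, u \<otimes>\<^bsub>A\<^esub> v)}),
     one = frac_rel A P `` {(\<one>\<^bsub>A\<^esub>, \<one>\<^bsub>A\<^esub>)},
     ring.zero = frac_rel A P `` {(\<zero>\<^bsub>A\<^esub>, \<one>\<^bsub>A\<^esub>)},
     add = (\<lambda>U V. \<Union>(a, u)\<in>U. \<Union>(b, v)\<in>V.
              frac_rel A P `` {((a \<otimes>\<^bsub>A\<^esub> v) \<oplus>\<^bsub>A\<^esub> (b \<otimes>\<^bsub>A\<^esub> u), u \<otimes>\<^bsub>A\<^esub> v)})\<rparr>"

definition gorenstein_ring :: "('a, 'm) ring_scheme \<Rightarrow> bool" where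
  "gorenstein_ring A \<longleftrightarrow> cring A \<and> noetherian_ring A \<and>
     (\<forall>P. primeideal P A \<longrightarrow> finite_self_injective_dimension (localization A P))"

section \<open>Grade\<close>

text \<open>
  Each entry is a nonzerodivisor modulo the ideal generated by the preceding ones, and the quotient
  by the whole sequence is nonzero.
\<close>
definition regular_sequence :: "('a, 'm) ring_scheme \<Rightarrow> 'a list \<Rightarrow> bool" where
  "regular_sequence A fs \<longleftrightarrow> set fs \<subseteq> carrier A \<and> genideal A (set fs) \<noteq> carrier A \<and>
     (\<forall>i<length fs. \<forall>g\<in>carrier A. (fs ! i) \<otimes>\<^bsub>A\<^esub> g \<in> genideal A (set (take i fs)) \<longrightarrow>
        g \<in> genideal A (set (take i fs)))"

definition grade :: "('a, 'm) ring_scheme \<Rightarrow> 'a set \<Rightarrow> enat" where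
  "grade A I = Sup {enat (length fs) | fs. regular_sequence A fs \<and> set fs \<subseteq> I}"

section \<open>The standard graded polynomial ring\<close>

text \<open>Polynomials over \<open>'k\<close> in the variables \<open>'x\<close>; a monomial is its exponent vector.\<close>
type_synonym ('x, 'k) mpoly = "('x \<Rightarrow>\<^sub>0 nat) \<Rightarrow>\<^sub>0 'k"

abbreviation PR :: "('x::finite, 'k::field) mpoly ring" where
  "PR \<equiv> ring_of_type_algebra"

definition mon_degree :: "('x::finite \<Rightarrow>\<^sub>0 nat) \<Rightarrow> nat" where
  "mon_degree m = (\<Sum>x\<in>UNIV. Poly_Mapping.lookup m x)"

text \<open>The zero polynomial is homogeneous of every degree, and only it has a negative degree.\<close>
definition homogeneous_of_degree :: "int \<Rightarrow> ('x::finite, 'k::field) mpoly \<Rightarrow> bool" where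
  "homogeneous_of_degree d f \<longleftrightarrow> (\<forall>m\<in>Poly_Mapping.keys f. int (mon_degree m) = d)"

definition homogeneous_ideal :: "('x::finite, 'k::field) mpoly set \<Rightarrow> bool" where
  "homogeneous_ideal I \<longleftrightarrow> (\<exists>G. (\<forall>g\<in>G. \<exists>d. homogeneous_of_degree d g) \<and> I = genideal PR G)"

definition indeterminate :: "'x \<Rightarrow> ('x::finite, 'k::field) mpoly" where
  "indeterminate x = Poly_Mapping.single (Poly_Mapping.single x 1) 1"

definition irrelevant_ideal :: "('x::finite, 'k::field) mpoly set" where
  "irrelevant_ideal = genideal PR (range indeterminate)"

section \<open>Hilbert coefficients\<close>

text \<open>The image of the coefficient field in the quotient by I.\<close>
definition quot_scalars :: "('x::finite, 'k::field) mpoly set \<Rightarrow> ('x, 'k) mpoly set set" where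
  "quot_scalars I = range (\<lambda>a. I +>\<^bsub>PR\<^esub> Poly_Mapping.single 0 a)"

text \<open>The degree i component of the quotient by I.\<close>
definition quot_component :: "('x::finite, 'k::field) mpoly set \<Rightarrow> nat \<Rightarrow> ('x, 'k) mpoly set set" where
  "quot_component I i = (\<lambda>f. I +>\<^bsub>PR\<^esub> f) ` {f. homogeneous_of_degree (int i) f}"

definition hilbert_function :: "('x::finite, 'k::field) mpoly set \<Rightarrow> nat \<Rightarrow> nat" where
  "hilbert_function I i = ring.dim (PR Quot I) (quot_scalars I) (quot_component I i)"

definition hilbert_series :: "('x::finite, 'k::field) mpoly set \<Rightarrow> rat fps" where
  "hilbert_series I = Abs_fps (\<lambda>i. of_nat (hilbert_function I i))"

text \<open>
  In the next two definitions d is the dimension of the quotient by I.  The polynomial Q with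
  Hilbert series \<open>Q(t) / (1 - t)^d\<close> is unique if it exists.
\<close>
definition hilbert_numerator :: "('x::finite, 'k::field) mpoly set \<Rightarrow> nat \<Rightarrow> rat poly" where
  "hilbert_numerator I d = (THE Q. fps_of_poly Q = hilbert_series I * (1 - fps_X) ^ d)"

definition hilbert_coefficient :: "('x::finite, 'k::field) mpoly set \<Rightarrow> nat \<Rightarrow> nat \<Rightarrow> rat" where
  "hilbert_coefficient I d l = poly ((pderiv ^^ l) (hilbert_numerator I d)) 1 / fact l"

section \<open>Minimal graded free resolutions\<close>

text \<open>
  The list \<open>D i\<close> holds the shifts of the i-th module: if \<open>D i = [d\<^sub>1, \<dots>, d\<^sub>m]\<close>, then
  \<open>F\<^sub>i = R(-d\<^sub>1) \<oplus> \<dots> \<oplus> R(-d\<^sub>m)\<close>, and \<open>F\<^sub>i = 0\<close> if \<open>D i = []\<close>.  The matrix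
  \<open>\<phi> i\<close> represents the differential from \<open>F\<^sub>i\<^sub>+\<^sub>1\<close> to \<open>F\<^sub>i\<close> acting on column vectors; it
  preserves degrees iff each entry (p, q) is homogeneous of degree \<open>D (i + 1) ! q - D i ! p\<close>.
  Finite resolutions are padded by zero modules on the left, so exactness at the leftmost nonzero
  module is injectivity.
\<close>
definition graded_free_resolution ::
    "('x::finite, 'k::field) mpoly set \<Rightarrow> (nat \<Rightarrow> int list) \<Rightarrow> (nat \<Rightarrow> ('x, 'k) mpoly mat) \<Rightarrow> bool" where
  "graded_free_resolution I D \<phi> \<longleftrightarrow>
     D 0 = [0] \<and>
     (\<forall>i. \<phi> i \<in> carrier_mat (length (D i)) (length (D (Suc i)))) \<and>
     (\<forall>i. \<forall>p<length (D i). \<forall>q<length (D (Suc i)).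
        homogeneous_of_degree (D (Suc i) ! q - D i ! p) (\<phi> i $$ (p, q))) \<and>
     {(\<phi> 0 *\<^sub>v v) $ 0 | v. v \<in> carrier_vec (length (D 1))} = I \<and>
     (\<forall>i. mat_kernel (\<phi> i) = {\<phi> (Suc i) *\<^sub>v v | v. v \<in> carrier_vec (length (D (Suc (Suc i))))})"

text \<open>Minimality: the image of each differential lies in \<open>(x\<^sub>1, \<dots>, x\<^sub>n) F\<^sub>i\<close>.\<close>
definition minimal_graded_free_resolution ::
    "('x::finite, 'k::field) mpoly set \<Rightarrow> (nat \<Rightarrow> int list) \<Rightarrow> (nat \<Rightarrow> ('x, 'k) mpoly mat) \<Rightarrow> bool" where
  "minimal_graded_free_resolution I D \<phi> \<longleftrightarrow> graded_free_resolution I D \<phi> \<and>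
     (\<forall>i. \<forall>p<length (D i). \<forall>q<length (D (Suc i)). \<phi> i $$ (p, q) \<in> irrelevant_ideal)"

text \<open>
  The shifts of the self-dual resolution of length \<open>2 k + 1\<close>; the position i in the right half is
  dual to the position \<open>2 k + 1 - i\<close> in the left half.
\<close>
definition gorenstein_shifts ::
    "nat \<Rightarrow> (nat \<Rightarrow> nat) \<Rightarrow> (nat \<Rightarrow> nat \<Rightarrow> int) \<Rightarrow> int \<Rightarrow> nat \<Rightarrow> int list" where
  "gorenstein_shifts k b a c i =
     (if i = 0 then [0]
      else if i \<le> k then map (\<lambda>j. a i j) [1..<Suc (b i)]
      else if i \<le> 2 * k then map (\<lambda>j. c - a (2 * k + 1 - i) j) [1..<Suc (b (2 * k + 1 - i))]
      else if i = 2 * k + 1 then [c]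
      else [])"

section \<open>The numbers \<nu>\<close>

text \<open>The elementary symmetric polynomial of degree q evaluated at \<open>1, \<dots>, s + l - 1\<close>.\<close>
definition nu :: "nat \<Rightarrow> nat \<Rightarrow> nat \<Rightarrow> nat" where
  "nu s l q = (\<Sum>B | B \<subseteq> {1..s + l - 1} \<and> card B = q. \<Prod>\<xi>\<in>B. \<xi>)"

end

theory Submission
  imports Defs "HOL-Library.Function_Algebras"
begin

text \<open>
  Write the Hilbert series as \<open>P(t) / (1 - t)\<^sup>n\<close>, where P is the alternating sum of the \<open>t\<^sup>d\<close> over the shifts d.
  A regular sequence of length s in I bounds the number of linearly independent elements of degree
  at most d in the quotient by a multiple of \<open>d\<^sup>n\<^sup>-\<^sup>s\<close>, so \<open>P = (1 - t)\<^sup>s Q\<close>.  Taylor expansion at \<open>t = 1\<close> shows that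
  \<open>(-1)\<^sup>s (s + l)! e\<^sub>l\<close> is the alternating sum of the falling factorials \<open>d (d - 1) \<dots> (d - s - l + 1)\<close>,
  and that the power sums of the shifts of order below s vanish.  Expanding the falling factorials
  produces the numbers \<open>\<nu>\<close> and the power sums of order \<open>s + r\<close> for \<open>r \<le> l\<close>.

  By the symmetry of the shifts, the power sums are sums of \<open>a\<^sup>m - (c - a)\<^sup>m\<close>, which is \<open>-(c - 2 a)\<close> times a
  polynomial in c and \<open>u = a (c - a)\<close>.  The vanishing of the odd ones below s kills the terms in which
  the exponent of u is less than k.
\<close>

section \<open>Linear algebra\<close>

text \<open>What the grade contributes is that \<open>(1 - t)^s\<close> divides P, and an upper
  bound for the growth suffices for that. The members of a regular sequence in \<open>I\<close> need
  not be homogeneous, so the growth is measured along the degree filtration instead of the grading: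
  multiplication by a member of degree at most e is injective modulo the preceding ones and moves
  degree at most d into degree at most d + e, which lowers the order of growth by one. The
  homogeneity of \<open>I\<close> serves to compare this filtered count with the Hilbert function.

  Dimensions are computed in vector spaces that fill a type, but quotients have no type of their
  own. A quotient by a subspace V is therefore replaced by the image of an endomorphism with kernel
  V, and the dimension of cosets is translated into this language separately.

  Minimality of the resolution enters through the sign of the shifts: since none is negative, P is a
  polynomial and not merely a Laurent polynomial, and its Taylor expansion at 1 is that of a
  polynomial.\<close>

context vector_space
begin

text \<open>An infinite basis has \<open>card\<close> 0, so \<open>dim\<close> is meaningful only
  below a finite spanning set. The polynomial ring is infinite-dimensional, hence the dimension
  counts carry such a set T.\<close>

lemma finite_basis_obtain:
  assumes "finite T" "S \<subseteq> span T"
  obtains B where "finite B" "B \<subseteq> S" "independent B" "S \<subseteq> span B" "card B = dim S"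
proof -
  obtain B where B: "B \<subseteq> S" "independent B" "S \<subseteq> span B" "card B = dim S"
    using basis_exists by blast
  with assms independent_span_bound[of T B] show ?thesis
    by (intro that[of B]) auto
qed

lemma dim_mono_finite_span:
  assumes "finite T" "U \<subseteq> span T" "S \<subseteq> span U"
  shows "dim S \<le> dim U"
proof -
  obtain B where B: "finite B" "B \<subseteq> U" "independent B" "U \<subseteq> span B" "card B = dim U"
    using finite_basis_obtain[OF assms(1,2)] .
  have "S \<subseteq> span B"
    using assms(3) B(4) span_minimal[OF _ subspace_span] by blast
  with B show ?thesis
    using dim_le_card[of S B] by simp
qed

lemma dim_zero_space: "dim {0} = 0"
  using dim_span_eq_card_independent[OF independent_empty] by simp

text \<open>Coordinates with respect to B are unique, and those of x are supported both in A and in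
  \<open>B - A\<close>.\<close>

lemma independent_Diff_Int_span:
  assumes "independent B" "A \<subseteq> B" "x \<in> span A" "x \<in> span (B - A)"
  shows "x = 0"
proof -
  have "representation B x b = 0" for b
  proof (cases "b \<in> A")
    case True
    then have "representation (B - A) x b = 0"
      using representation_ne_zero[of "B - A" x b] by auto
    then show ?thesis
      using representation_extend[OF assms(1,4)] by auto
  next
    case False
    then have "representation A x b = 0"
      using representation_ne_zero[of A x b] by auto
    then show ?thesis
      using representation_extend[OF assms(1,3,2)] by auto
  qed
  moreover have "x \<in> span B"
    using assms(2,3) span_mono by blast
  ultimately show ?thesis
    using sum_nonzero_representation_eq[OF assms(1)] by (metis (mono_tags, lifting) Collect_empty_eq sum.empty)
qed

end

context vector_space_pair
begin

text \<open>A basis of the kernel inside S extends to a basis of S, and f is injective on the span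
  of the added vectors. The form with a subspace S is the one that applies to the finite-dimensional
  pieces of an infinite-dimensional space.\<close>

lemma rank_nullity_subspace:
  assumes lin: "Vector_Spaces.linear s1 s2 f" and S: "vs1.subspace S" and T: "finite T" "S \<subseteq> vs1.span T"
  shows "vs1.dim S = vs1.dim {x \<in> S. f x = 0} + vs2.dim (f ` S)"
proof -
  interpret f: Vector_Spaces.linear s1 s2 f by fact
  define N where "N = {x \<in> S. f x = 0}"
  have NS: "N \<subseteq> S" by (auto simp: N_def)
  obtain A where A: "finite A" "A \<subseteq> N" "vs1.independent A" "N \<subseteq> vs1.span A" "card A = vs1.dim N"
    using vs1.finite_basis_obtain[of T N] T NS by blast
  obtain B where B: "A \<subseteq> B" "B \<subseteq> S" "vs1.independent B" "S \<subseteq> vs1.span B"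
    using vs1.maximal_independent_subset_extend[of A S] A NS by blast
  have fB: "finite B"
    using vs1.independent_span_bound[of T B] B T by blast
  have dimS: "card B = vs1.dim S"
    using vs1.basis_card_eq_dim B by blast
  define C where "C = B - A"
  have spanC: "vs1.span C \<subseteq> S"
    using B C_def by (intro vs1.span_minimal S) auto
  have inj: "inj_on f (vs1.span C)"
  proof (subst f.inj_on_iff_eq_0)
    show "\<forall>x\<in>vs1.span C. f x = 0 \<longrightarrow> x = 0"
      using vs1.independent_Diff_Int_span[OF B(3,1)] A spanC unfolding N_def C_def by blast
  qed (rule vs1.subspace_span)
  have iC: "vs2.independent (f ` C)"
    using f.independent_injective_image[OF _ inj] vs1.independent_mono[OF B(3)] C_def by blast
  have cardC: "card (f ` C) = card C"
    using inj_on_subset[OF inj vs1.span_superset] by (rule card_image)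
  have "f ` S \<subseteq> f ` vs1.span B"
    using B(4) by blast
  also have "\<dots> = vs2.span (f ` B)"
    using f.span_image by blast
  also have "f ` B \<subseteq> insert 0 (f ` C)"
    using A(2) unfolding C_def N_def by auto
  then have "vs2.span (f ` B) \<subseteq> vs2.span (insert 0 (f ` C))"
    by (rule vs2.span_mono)
  finally have "f ` S \<subseteq> vs2.span (f ` C)" by simp
  moreover have "f ` C \<subseteq> f ` S"
    using B C_def by blast
  ultimately have "vs2.dim (f ` S) = card C"
    using vs2.basis_card_eq_dim[OF _ _ iC] cardC by simp
  moreover have "card B = card A + card C"
    using fB B(1) C_def card_mono[OF fB B(1)] card_Diff_subset[OF A(1) B(1)] by simp
  ultimately show ?thesis
    using dimS A(5) N_def by simp
qed

end

context vector_space
begin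

text \<open>Substitute for the quotient map: p kills a basis of V and fixes the vectors that
  complete it to a basis, so dimensions modulo V become dimensions of images within the same
  type.\<close>

lemma exists_linear_with_kernel:
  assumes V: "subspace V"
  shows "\<exists>p. Vector_Spaces.linear scale scale p \<and> (\<forall>x. p x = 0 \<longleftrightarrow> x \<in> V)"
proof -
  interpret vs: vector_space_pair scale scale by unfold_locales
  obtain A where A: "A \<subseteq> V" "independent A" "V \<subseteq> span A"
    using maximal_independent_subset by blast
  have spanA: "span A = V"
    using A span_minimal V by blast
  define B where "B = extend_basis A"
  have B: "A \<subseteq> B" "independent B" "span B = UNIV"
    using A unfolding B_def by (auto simp: extend_basis_superset independent_extend_basis)
  obtain p where p: "Vector_Spaces.linear scale scale p" "\<forall>x\<in>B. p x = (if x \<in> A then 0 else x)"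
    using vs.linear_independent_extend[OF B(2), of "\<lambda>x. if x \<in> A then 0 else x"] by blast
  interpret p: Vector_Spaces.linear scale scale p by fact
  have p0: "p x = 0" if "x \<in> span A" for x
    by (rule p.eq_0_on_span[OF _ that]) (use p(2) B(1) in auto)
  have p1: "p x = x" if "x \<in> span (B - A)" for x
    by (rule vs.linear_eq_on[OF p(1) linear_ident that]) (use p(2) in auto)
  have "x \<in> V" if "p x = 0" for x
  proof -
    have "x \<in> span (A \<union> (B - A))"
      using B by (simp add: Un_absorb1)
    then obtain y z where yz: "x = y + z" "y \<in> span A" "z \<in> span (B - A)"
      unfolding span_Un by blast
    then have "p x = z"
      by (simp add: p.add p0 p1)
    then show ?thesis
      using that yz spanA by simp
  qed
  then show ?thesis
    using p p0 spanA by blast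
qed

end

section \<open>Polynomials and their ideals as vector spaces\<close>

definition mscale :: "'k \<Rightarrow> ('x::finite, 'k::field) mpoly \<Rightarrow> ('x, 'k) mpoly" where
  "mscale a f = Poly_Mapping.single 0 a * f"

lemma lookup_mscale [simp]: "poly_mapping.lookup (mscale a f) m = a * poly_mapping.lookup f m"
  unfolding mscale_def mult_map_scale_conv_mult[symmetric] by (simp add: Poly_Mapping.map.rep_eq when_def)

lemma mscale_mult: "mscale a (f * g) = f * mscale a g"
  by (simp add: mscale_def mult.left_commute)

interpretation mp: vector_space mscale
  by unfold_locales (auto intro!: poly_mapping_eqI simp: lookup_add algebra_simps)

interpretation mpp: vector_space_pair mscale mscale
  by unfold_locales

text \<open>One form for all support conditions: the degree filtration, the grading, the complement
  of a single degree and the polynomials without constant term are instances.\<close>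

definition mspace :: "('x::finite \<Rightarrow>\<^sub>0 nat) set \<Rightarrow> ('x, 'k::field) mpoly set" where
  "mspace M = {f. Poly_Mapping.keys f \<subseteq> M}"

lemma mspace_iff: "f \<in> mspace M \<longleftrightarrow> (\<forall>m. m \<notin> M \<longrightarrow> poly_mapping.lookup f m = 0)"
  by (auto simp: mspace_def in_keys_iff)

lemma subspace_mspace: "mp.subspace (mspace M)"
  by (intro mp.subspaceI) (auto simp: mspace_iff lookup_add)

lemma lookup_sum_single:
  "finite A \<Longrightarrow> poly_mapping.lookup (\<Sum>m\<in>A. mscale (u m) (Poly_Mapping.single m 1)) m' = (if m' \<in> A then u m' else 0)"
  by (simp add: lookup_sum lookup_single when_def if_distrib[of "\<lambda>x. _ * x"] cong: if_cong)

lemma mpoly_expand: "f = (\<Sum>m\<in>Poly_Mapping.keys f. mscale (poly_mapping.lookup f m) (Poly_Mapping.single m 1))"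
  by (intro poly_mapping_eqI) (simp add: lookup_sum_single in_keys_iff)

lemma mspace_subset_span: "mspace M \<subseteq> mp.span ((\<lambda>m. Poly_Mapping.single m 1) ` M)"
proof
  fix f :: "('a, 'b) mpoly" assume "f \<in> mspace M"
  then show "f \<in> mp.span ((\<lambda>m. Poly_Mapping.single m 1) ` M)"
    by (subst mpoly_expand, intro mp.span_sum mp.span_scale mp.span_base) (auto simp: mspace_def)
qed

lemma dim_mspace:
  assumes "finite M"
  shows "mp.dim (mspace M :: ('x::finite, 'k::field) mpoly set) = card M"
proof -
  let ?s = "\<lambda>m. Poly_Mapping.single m (1::'k)"
  have inj: "inj_on ?s M"
    by (intro inj_onI) (metis lookup_single_eq lookup_single_not_eq zero_neq_one)
  have "mp.independent (?s ` M)"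
  proof (rule mp.independent_if_scalars_zero)
    fix u x assume sum: "(\<Sum>x\<in>?s ` M. mscale (u x) x) = 0" and "x \<in> ?s ` M"
    then obtain m where m: "m \<in> M" "x = ?s m" by blast
    have "(\<Sum>m\<in>M. mscale (u (?s m)) (?s m)) = 0"
      using sum by (simp add: sum.reindex[OF inj])
    then have "poly_mapping.lookup (\<Sum>m\<in>M. mscale (u (?s m)) (?s m)) m = 0" by simp
    then show "u x = 0"
      using m assms by (simp add: lookup_sum_single)
  qed (use assms in simp)
  moreover have "?s ` M \<subseteq> mspace M"
    by (auto simp: mspace_def)
  ultimately show ?thesis
    using mp.basis_card_eq_dim[OF _ mspace_subset_span] card_image[OF inj] by metis
qed

section \<open>Degrees of monomials and spaces of bounded or fixed degree\<close>

lemma mon_degree_add: "mon_degree (m + m') = mon_degree m + mon_degree m'"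
  by (simp add: mon_degree_def lookup_add sum.distrib)

lemma mon_degree_0 [simp]: "mon_degree 0 = 0"
  by (simp add: mon_degree_def)

lemma lookup_le_mon_degree: "poly_mapping.lookup m x \<le> mon_degree m"
  unfolding mon_degree_def by (intro member_le_sum) auto

text \<open>Each exponent is at most d. The bound is crude, but only its order of growth
  matters.\<close>

lemma finite_mon_degree_le: "finite {m :: 'x::finite \<Rightarrow>\<^sub>0 nat. mon_degree m \<le> d}"
  and card_mon_degree_le: "card {m :: 'x::finite \<Rightarrow>\<^sub>0 nat. mon_degree m \<le> d} \<le> (d + 1) ^ CARD('x)"
proof -
  have fin: "finite (UNIV \<rightarrow>\<^sub>E {..d} :: ('x \<Rightarrow> nat) set)"
    by (intro finite_PiE) auto
  have sub: "poly_mapping.lookup ` {m :: 'x::finite \<Rightarrow>\<^sub>0 nat. mon_degree m \<le> d} \<subseteq> UNIV \<rightarrow>\<^sub>E {..d}"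
    using lookup_le_mon_degree order_trans by fastforce
  have inj: "inj_on poly_mapping.lookup {m :: 'x::finite \<Rightarrow>\<^sub>0 nat. mon_degree m \<le> d}"
    by (simp add: inj_on_def lookup_inject)
  show "finite {m :: 'x::finite \<Rightarrow>\<^sub>0 nat. mon_degree m \<le> d}"
    using finite_imageD[OF finite_subset[OF sub fin] inj] .
  have "card {m :: 'x::finite \<Rightarrow>\<^sub>0 nat. mon_degree m \<le> d} \<le> card (UNIV \<rightarrow>\<^sub>E {..d} :: ('x \<Rightarrow> nat) set)"
    using card_inj_on_le[OF inj sub fin] .
  also have "\<dots> = (d + 1) ^ CARD('x)"
    by (simp add: card_PiE)
  finally show "card {m :: 'x::finite \<Rightarrow>\<^sub>0 nat. mon_degree m \<le> d} \<le> (d + 1) ^ CARD('x)" .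
qed

lemma finite_mon_degree_eq: "finite {m :: 'x::finite \<Rightarrow>\<^sub>0 nat. int (mon_degree m) = d}"
  by (rule finite_subset[OF _ finite_mon_degree_le[of "nat d"]]) auto

lemma mspace_mult:
  assumes "f \<in> mspace M" "g \<in> mspace N" "\<And>m n. m \<in> M \<Longrightarrow> n \<in> N \<Longrightarrow> m + n \<in> P"
  shows "f * g \<in> mspace P"
  using keys_mult[of f g] assms unfolding mspace_def by blast

abbreviation mdeg_le :: "nat \<Rightarrow> ('x::finite, 'k::field) mpoly set" where
  "mdeg_le d \<equiv> mspace {m. mon_degree m \<le> d}"

abbreviation mdeg_eq :: "int \<Rightarrow> ('x::finite, 'k::field) mpoly set" where
  "mdeg_eq d \<equiv> mspace {m. int (mon_degree m) = d}"

lemma homogeneous_iff: "homogeneous_of_degree d f \<longleftrightarrow> f \<in> mdeg_eq d"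
  by (auto simp: homogeneous_of_degree_def mspace_def)

lemma mpoly_bounded_degree: obtains e where "f \<in> mdeg_le e"
proof
  show "f \<in> mdeg_le (Max (mon_degree ` Poly_Mapping.keys f))"
    by (auto simp: mspace_def)
qed

text \<open>The ideals of \<open>PR\<close> in terms of type class operations; closure under
  negation comes from the multiplier -1.\<close>

definition poly_ideal :: "('x::finite, 'k::field) mpoly set \<Rightarrow> bool" where
  "poly_ideal J \<longleftrightarrow> 0 \<in> J \<and> (\<forall>f\<in>J. \<forall>g\<in>J. f + g \<in> J) \<and> (\<forall>f\<in>J. \<forall>g. g * f \<in> J)"

lemma poly_idealD:
  assumes "poly_ideal J"
  shows "0 \<in> J" "f \<in> J \<Longrightarrow> g \<in> J \<Longrightarrow> f + g \<in> J" "f \<in> J \<Longrightarrow> g * f \<in> J" "f \<in> J \<Longrightarrow> f * g \<in> J"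
  using assms by (auto simp: poly_ideal_def mult.commute)

lemma subspace_poly_ideal: "poly_ideal J \<Longrightarrow> mp.subspace J"
  by (intro mp.subspaceI) (auto simp: mscale_def poly_idealD)

lemma poly_ideal_sum: "poly_ideal J \<Longrightarrow> (\<And>x. x \<in> A \<Longrightarrow> f x \<in> J) \<Longrightarrow> sum f A \<in> J"
  using mp.subspace_sum[OF subspace_poly_ideal] .

lemma PR_simps [simp]: "carrier PR = UNIV" "f \<otimes>\<^bsub>PR\<^esub> g = f * g" "f \<oplus>\<^bsub>PR\<^esub> g = f + g"
  "\<zero>\<^bsub>PR\<^esub> = 0" "\<one>\<^bsub>PR\<^esub> = 1"
  by (simp_all add: ring_of_type_algebra_def)

lemma cring_PR: "cring (PR :: ('x::finite, 'k::field) mpoly ring)"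
  by (rule cring_from_type_algebra)

lemma ideal_PR_imp_poly_ideal: "ideal J PR \<Longrightarrow> poly_ideal J"
  unfolding poly_ideal_def
  using ideal.I_l_closed[of J PR] additive_subgroup.a_closed[of J PR] additive_subgroup.zero_closed[of J PR]
  by (auto simp: ideal.axioms)

lemma poly_ideal_imp_ideal_PR:
  assumes "poly_ideal J" shows "ideal J PR"
proof -
  interpret cring "PR :: ('a, 'b) mpoly ring" by (rule cring_PR)
  have minv: "\<ominus>\<^bsub>PR\<^esub> f = - f" for f :: "('a, 'b) mpoly"
    by (rule minus_equality) simp_all
  show ?thesis
  proof (rule idealI)
    show "subgroup J (add_monoid PR)"
      using poly_idealD(3)[OF assms, of _ "-1"] poly_idealD(1,2)[OF assms]
      by (intro add.subgroupI) (auto simp: minv)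
  qed (use assms in \<open>auto simp: poly_idealD intro: ring_axioms\<close>)
qed

lemma poly_ideal_genideal: "poly_ideal (genideal PR G)"
proof -
  interpret cring "PR :: ('a, 'b) mpoly ring" by (rule cring_PR)
  show ?thesis
    by (rule ideal_PR_imp_poly_ideal) (simp add: genideal_ideal)
qed

lemma genideal_superset: "G \<subseteq> genideal PR G"
  by (auto simp: genideal_def)

lemma genideal_least: "poly_ideal J \<Longrightarrow> G \<subseteq> J \<Longrightarrow> genideal PR G \<subseteq> J"
  using poly_ideal_imp_ideal_PR by (auto simp: genideal_def)

section \<open>Growth of the Hilbert function and regular sequences\<close>

text \<open>The affine Hilbert function, which makes sense for ideals that are not homogeneous, such
  as those generated by a part of a regular sequence. The truncated subtraction is exact, because
  the second space lies in the first.\<close>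

definition affine_hilbert :: "('x::finite, 'k::field) mpoly set \<Rightarrow> nat \<Rightarrow> nat" where
  "affine_hilbert J d = mp.dim (mdeg_le d :: ('x, 'k) mpoly set) - mp.dim (J \<inter> mdeg_le d)"

lemma mdeg_le_finite_span:
  "\<exists>T. finite T \<and> (mdeg_le d :: ('x::finite, 'k::field) mpoly set) \<subseteq> mp.span T"
  by (intro exI conjI, rule finite_imageI[OF finite_mon_degree_le], rule mspace_subset_span)

lemma mdeg_eq_finite_span:
  "\<exists>T. finite T \<and> (mdeg_eq d :: ('x::finite, 'k::field) mpoly set) \<subseteq> mp.span T"
  by (intro exI conjI, rule finite_imageI[OF finite_mon_degree_eq], rule mspace_subset_span)

lemma poly_ideal_projection:
  fixes J :: "('x::finite, 'k::field) mpoly set"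
  assumes "poly_ideal J"
  obtains p :: "('x, 'k) mpoly \<Rightarrow> ('x, 'k) mpoly" where "Vector_Spaces.linear mscale mscale p" "\<And>f. p f = 0 \<longleftrightarrow> f \<in> J"
  using mp.exists_linear_with_kernel[OF subspace_poly_ideal[OF assms]] by auto

lemma affine_hilbert_eq_dim_image:
  fixes J :: "('a::finite, 'b::field) mpoly set" and p :: "('a, 'b) mpoly \<Rightarrow> ('a, 'b) mpoly"
  assumes p: "Vector_Spaces.linear mscale mscale p" "\<And>f. p f = 0 \<longleftrightarrow> f \<in> J"
  shows "affine_hilbert J d = mp.dim (p ` mdeg_le d)"
proof -
  obtain T where T: "finite T" "(mdeg_le d :: ('a, 'b) mpoly set) \<subseteq> mp.span T"
    using mdeg_le_finite_span by blast
  have "{f \<in> mdeg_le d. p f = 0} = J \<inter> mdeg_le d"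
    using p by auto
  then show ?thesis
    using mpp.rank_nullity_subspace[OF p(1) subspace_mspace T] by (simp add: affine_hilbert_def)
qed

lemma linear_image_finite_span:
  fixes p :: "('x::finite, 'k::field) mpoly \<Rightarrow> ('x, 'k) mpoly"
  assumes "Vector_Spaces.linear mscale mscale p" "finite T" "S \<subseteq> mp.span T"
  shows "finite (p ` T)" "p ` S \<subseteq> mp.span (p ` T)"
proof -
  interpret p: Vector_Spaces.linear mscale mscale p by fact
  show "p ` S \<subseteq> mp.span (p ` T)"
    using assms(3) p.span_image by blast
qed (use assms in simp)

lemma mspace_mono: "M \<subseteq> N \<Longrightarrow> mspace M \<subseteq> mspace N"
  by (auto simp: mspace_def)

lemma affine_hilbert_mono:
  fixes J :: "('a::finite, 'b::field) mpoly set"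
  assumes "poly_ideal J" "d \<le> d'"
  shows "affine_hilbert J d \<le> affine_hilbert J d'"
proof -
  obtain p :: "('a, 'b) mpoly \<Rightarrow> ('a, 'b) mpoly" where p: "Vector_Spaces.linear mscale mscale p" "\<And>f. p f = 0 \<longleftrightarrow> f \<in> J"
    using poly_ideal_projection[OF assms(1)] by blast
  obtain T where T: "finite T" "(mdeg_le d' :: ('a, 'b) mpoly set) \<subseteq> mp.span T"
    using mdeg_le_finite_span by blast
  have "p ` mdeg_le d \<subseteq> p ` mdeg_le d'"
    using assms(2) by (intro image_mono mspace_mono) auto
  then have "p ` mdeg_le d \<subseteq> mp.span (p ` mdeg_le d')"
    by (rule order_trans[OF _ mp.span_superset])
  then show ?thesis
    unfolding affine_hilbert_eq_dim_image[OF p]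
    by (rule mp.dim_mono_finite_span[OF linear_image_finite_span[OF p(1) T]])
qed

lemma affine_hilbert_pos:
  fixes J :: "('a::finite, 'b::field) mpoly set"
  assumes "poly_ideal J" "1 \<notin> J"
  shows "affine_hilbert J d \<ge> 1"
proof -
  obtain p :: "('a, 'b) mpoly \<Rightarrow> ('a, 'b) mpoly" where p: "Vector_Spaces.linear mscale mscale p" "\<And>f. p f = 0 \<longleftrightarrow> f \<in> J"
    using poly_ideal_projection[OF assms(1)] by blast
  obtain T where T: "finite T" "(mdeg_le d :: ('a, 'b) mpoly set) \<subseteq> mp.span T"
    using mdeg_le_finite_span by blast
  obtain B where B: "finite B" "p ` mdeg_le d \<subseteq> mp.span B" "card B = mp.dim (p ` mdeg_le d)"
    using mp.finite_basis_obtain[OF linear_image_finite_span[OF p(1) T]] by metis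
  have "p 1 \<in> mp.span B"
    using B(2) by (auto simp: mspace_def)
  moreover have "p 1 \<noteq> 0"
    using p assms by blast
  ultimately have "B \<noteq> {}" by auto
  then have "card B > 0"
    using B(1) by (simp add: card_gt_0_iff)
  then show ?thesis
    unfolding affine_hilbert_eq_dim_image[OF p] B(3)[symmetric] by simp
qed

lemma affine_hilbert_antimono:
  fixes J :: "('a::finite, 'b::field) mpoly set"
  assumes "J \<subseteq> J'" shows "affine_hilbert J' d \<le> affine_hilbert J d"
proof -
  obtain T where T: "finite T" "(mdeg_le d :: ('a, 'b) mpoly set) \<subseteq> mp.span T"
    using mdeg_le_finite_span by blast
  have "mp.dim (J \<inter> mdeg_le d) \<le> mp.dim (J' \<inter> mdeg_le d)"
    using T assms by (intro mp.dim_mono_finite_span[OF T(1)]) (auto intro: mp.span_base)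
  then show ?thesis
    by (simp add: affine_hilbert_def)
qed

text \<open>Multiplication by f embeds the polynomials of degree at most \<open>d\<close> modulo J into the kernel
  of the projection from the polynomials of degree at most \<open>d + e\<close> modulo J to those modulo J'.\<close>
lemma affine_hilbert_regular_step:
  fixes f :: "('x::finite, 'k::field) mpoly"
  assumes J: "poly_ideal J" and J': "poly_ideal J'" "J \<subseteq> J'" "f \<in> J'"
    and f: "f \<in> mdeg_le e" and reg: "\<And>g. f * g \<in> J \<Longrightarrow> g \<in> J"
  shows "affine_hilbert J' (d + e) + affine_hilbert J d \<le> affine_hilbert J (d + e)"
proof -
  obtain p :: "('x, 'k) mpoly \<Rightarrow> ('x, 'k) mpoly" where p: "Vector_Spaces.linear mscale mscale p" "\<And>f. p f = 0 \<longleftrightarrow> f \<in> J"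
    using poly_ideal_projection[OF J] by blast
  interpret p: Vector_Spaces.linear mscale mscale p by fact
  obtain T where T: "finite T" "(mdeg_le (d + e) :: ('x, 'k) mpoly set) \<subseteq> mp.span T"
    using mdeg_le_finite_span by blast
  obtain T' where T': "finite T'" "(mdeg_le d :: ('x, 'k) mpoly set) \<subseteq> mp.span T'"
    using mdeg_le_finite_span by blast
  have lin: "Vector_Spaces.linear mscale mscale (\<lambda>g. p (f * g))"
    by unfold_locales (simp_all add: distrib_left p.add p.scale mscale_mult[symmetric])
  let ?U = "J' \<inter> mdeg_le (d + e)"
  have ker_U: "{g \<in> ?U. p g = 0} = J \<inter> mdeg_le (d + e)"
    unfolding p(2) using J'(2) by blast
  have ker_mult: "{g \<in> mdeg_le d. p (f * g) = 0} = J \<inter> mdeg_le d"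
    unfolding p(2) using reg poly_idealD(3)[OF J] by blast
  have U: "mp.dim ?U = mp.dim (J \<inter> mdeg_le (d + e)) + mp.dim (p ` ?U)"
    unfolding ker_U[symmetric] using T
    by (intro mpp.rank_nullity_subspace[OF p(1) _ T(1)] mp.subspace_inter subspace_mspace subspace_poly_ideal J') auto
  have image: "mp.dim ((\<lambda>g. p (f * g)) ` mdeg_le d) \<le> mp.dim (p ` ?U)"
  proof (rule mp.dim_mono_finite_span)
    show "finite (p ` T)" "p ` ?U \<subseteq> mp.span (p ` T)"
      using linear_image_finite_span[OF p(1) T(1), of ?U] T(2) by auto
    have "f * g \<in> mdeg_le (d + e)" if "g \<in> mdeg_le d" for g
      by (rule mspace_mult[OF f that]) (simp add: mon_degree_add)
    then have "f * g \<in> ?U" if "g \<in> mdeg_le d" for g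
      using poly_idealD(4)[OF J'(1,3)] that by blast
    then show "(\<lambda>g. p (f * g)) ` mdeg_le d \<subseteq> mp.span (p ` ?U)"
      by (auto intro!: mp.span_base)
  qed
  have mult: "mp.dim (mdeg_le d :: ('x, 'k) mpoly set) =
      mp.dim (J \<inter> mdeg_le d) + mp.dim ((\<lambda>g. p (f * g)) ` mdeg_le d)"
    unfolding ker_mult[symmetric] by (rule mpp.rank_nullity_subspace[OF lin subspace_mspace T'])
  have le: "mp.dim ?U \<le> mp.dim (mdeg_le (d + e) :: ('x, 'k) mpoly set)"
    by (rule mp.dim_mono_finite_span[OF T]) (auto intro: mp.span_base)
  \<comment> \<open>The condition \<open>u \<le> r'\<close> keeps the truncated difference
    \<open>r' - u\<close> exact.\<close>
  have arith: "r' - u + (r - j) \<le> r' - j'" if "u = j' + i'" "i \<le> i'" "r = j + i" "u \<le> r'"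
    for r r' u j j' i i' :: nat
    using that by linarith
  show ?thesis
    unfolding affine_hilbert_def by (rule arith[OF U image mult le])
qed

text \<open>Each increase of the degree by e gains at least one more copy of the count for J', since
  these counts do not decrease with the degree.\<close>

lemma affine_hilbert_regular_multiple:
  fixes f :: "('x::finite, 'k::field) mpoly"
  assumes J: "poly_ideal J" and J': "poly_ideal J'" "J \<subseteq> J'" "f \<in> J'"
    and f: "f \<in> mdeg_le e" and reg: "\<And>g. f * g \<in> J \<Longrightarrow> g \<in> J"
  shows "m * affine_hilbert J' d \<le> affine_hilbert J (d + m * e)"
proof (induction m)
  case (Suc m)
  have "affine_hilbert J' d \<le> affine_hilbert J' (d + m * e + e)"
    by (rule affine_hilbert_mono[OF J'(1)]) simp
  moreover have "affine_hilbert J' (d + m * e + e) + affine_hilbert J (d + m * e) \<le> affine_hilbert J (d + m * e + e)"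
    by (rule affine_hilbert_regular_step[OF assms])
  ultimately show ?case
    using Suc by (simp add: algebra_simps)
qed simp

text \<open>Taking \<open>m = d + 1\<close> in the preceding bound trades a factor
  \<open>d + 1\<close> for a linear change of the degree, which only affects the constant. The start
  of the induction is the count of all monomials.\<close>

lemma regular_sequence_growth:
  fixes fs :: "('x::finite, 'k::field) mpoly list"
  assumes "regular_sequence PR fs" "i \<le> length fs"
  shows "\<exists>C. \<forall>d. (d + 1) ^ i * affine_hilbert (genideal PR (set (take i fs))) d \<le> C * (d + 1) ^ CARD('x)"
  using assms(2)
proof (induction i)
  case 0
  have "affine_hilbert (genideal PR {} :: ('x, 'k) mpoly set) d \<le> (d + 1) ^ CARD('x)" for d
    using card_mon_degree_le[where 'x = 'x, of d] dim_mspace[OF finite_mon_degree_le, where 'k = 'k and 'x = 'x, of d]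
    unfolding affine_hilbert_def by linarith
  then show ?case
    by (intro exI[of _ 1]) simp
next
  case (Suc i)
  let ?J = "\<lambda>i. genideal PR (set (take i fs))"
  obtain C where C: "\<And>d. (d + 1) ^ i * affine_hilbert (?J i) d \<le> C * (d + 1) ^ CARD('x)"
    using Suc by auto
  obtain e where e: "fs ! i \<in> mdeg_le e"
    using mpoly_bounded_degree .
  have set: "set (take (Suc i) fs) = insert (fs ! i) (set (take i fs))"
    using Suc.prems by (simp add: take_Suc_conv_app_nth)
  have sup: "insert (fs ! i) (set (take i fs)) \<subseteq> ?J (Suc i)"
    using genideal_superset unfolding set[symmetric] .
  have sub: "?J i \<subseteq> ?J (Suc i)" "fs ! i \<in> ?J (Suc i)"
    using genideal_least[OF poly_ideal_genideal, of "set (take i fs)"] sup by simp_all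
  have reg: "g \<in> ?J i" if "fs ! i * g \<in> ?J i" for g
    using assms(1) Suc.prems that by (auto simp: regular_sequence_def)
  show ?case
  proof (intro exI[of _ "C * (1 + e) ^ CARD('x)"] allI)
    fix d
    \<comment> \<open>The degree reached after \<open>d + 1\<close> steps of size e; with this
      number of steps \<open>D + 1\<close> is a multiple of \<open>d + 1\<close>.\<close>
    define D where "D = d + (d + 1) * e"
    have D: "D + 1 = (d + 1) * (1 + e)"
      by (simp add: D_def algebra_simps)
    have "(d + 1) * affine_hilbert (?J (Suc i)) d \<le> affine_hilbert (?J i) D"
      unfolding D_def by (rule affine_hilbert_regular_multiple[OF poly_ideal_genideal poly_ideal_genideal sub e reg])
    then have "(d + 1) ^ Suc i * affine_hilbert (?J (Suc i)) d \<le> (d + 1) ^ i * affine_hilbert (?J i) D"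
      using mult_le_mono2 by (simp only: power_Suc2 mult.assoc)
    also have "\<dots> \<le> (D + 1) ^ i * affine_hilbert (?J i) D"
      by (intro mult_right_mono power_mono) (auto simp: D_def)
    also have "\<dots> \<le> C * (D + 1) ^ CARD('x)"
      by (rule C)
    also have "\<dots> = C * (1 + e) ^ CARD('x) * (d + 1) ^ CARD('x)"
      unfolding D power_mult_distrib by simp
    finally show "(d + 1) ^ Suc i * affine_hilbert (?J (Suc i)) d \<le> C * (1 + e) ^ CARD('x) * (d + 1) ^ CARD('x)" .
  qed
qed

lemma grade_growth:
  fixes I :: "('x::finite, 'k::field) mpoly set"
  assumes I: "poly_ideal I" and grade: "grade PR I = enat s" and "s > 0"
  shows "s \<le> CARD('x)" and "\<exists>C. \<forall>d. affine_hilbert I d \<le> C * (d + 1) ^ (CARD('x) - s)"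
proof -
  define A where "A = {enat (length fs) | fs. regular_sequence PR fs \<and> set fs \<subseteq> I}"
  have "Sup A = enat s"
    using grade by (simp add: grade_def A_def)
  \<comment> \<open>The supremum of the empty set is 0 and that of an infinite set is infinite, so a
    finite positive supremum is attained.\<close>
  then have "enat s \<in> A"
    using Max_in[of A] \<open>s > 0\<close> by (auto simp: Sup_enat_def zero_enat_def simp del: Max_in split: if_splits)
  then obtain fs where fs: "regular_sequence PR fs" "set fs \<subseteq> I" "length fs = s"
    by (auto simp: A_def)
  define J where "J = genideal PR (set fs)"
  obtain C where C: "\<And>d. (d + 1) ^ s * affine_hilbert J d \<le> C * (d + 1) ^ CARD('x)"
    using regular_sequence_growth[OF fs(1), of s] fs(3) by (auto simp: J_def)
  have J: "poly_ideal J"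
    unfolding J_def by (rule poly_ideal_genideal)
  have "1 \<notin> J"
    using fs(1) poly_idealD(3)[OF J, of 1] by (auto simp: regular_sequence_def J_def)
  show le: "s \<le> CARD('x)"
  proof (rule ccontr)
    assume "\<not> s \<le> CARD('x)"
    \<comment> \<open>The growth bound is tested at degree C, where it would force
      \<open>C + 1 \<le> C\<close>, because the quotient by J is nonzero.\<close>
    then have "(C + 1) ^ (CARD('x) + 1) \<le> (C + 1) ^ s"
      by (intro power_increasing) auto
    also have "\<dots> \<le> (C + 1) ^ s * affine_hilbert J C"
      using affine_hilbert_pos[OF J \<open>1 \<notin> J\<close>] by simp
    also have "\<dots> \<le> C * (C + 1) ^ CARD('x)"
      by (rule C)
    finally show False by simp
  qed
  have "affine_hilbert I d \<le> C * (d + 1) ^ (CARD('x) - s)" for d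
  proof -
    have "(d + 1) ^ s * affine_hilbert J d \<le> (d + 1) ^ s * (C * (d + 1) ^ (CARD('x) - s))"
      using C[of d] le by (simp add: power_add[symmetric] mult.left_commute)
    then have "affine_hilbert J d \<le> C * (d + 1) ^ (CARD('x) - s)"
      by (subst (asm) mult_le_cancel1) simp
    moreover have "J \<subseteq> I"
      unfolding J_def by (rule genideal_least[OF I fs(2)])
    ultimately show ?thesis
      using affine_hilbert_antimono order_trans by blast
  qed
  then show "\<exists>C. \<forall>d. affine_hilbert I d \<le> C * (d + 1) ^ (CARD('x) - s)"
    by blast
qed

section \<open>Homogeneous components and the graded count\<close>

definition hcomp :: "int \<Rightarrow> ('x::finite, 'k::field) mpoly \<Rightarrow> ('x, 'k) mpoly" where
  "hcomp d = Poly_Mapping.mapp (\<lambda>m c. c when int (mon_degree m) = d)"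

lemma lookup_hcomp: "poly_mapping.lookup (hcomp d f) m = (poly_mapping.lookup f m when int (mon_degree m) = d)"
  by (simp add: hcomp_def lookup_mapp when_def in_keys_iff)

lemma hcomp_in_mdeg_eq: "hcomp d f \<in> mdeg_eq d"
  by (simp add: mspace_iff lookup_hcomp)

lemma hcomp_id: "f \<in> mdeg_eq d \<Longrightarrow> hcomp d f = f"
  by (intro poly_mapping_eqI) (auto simp: mspace_iff lookup_hcomp when_def)

lemma hcomp_eq_0: "f \<in> mspace {m. int (mon_degree m) \<noteq> d} \<Longrightarrow> hcomp d f = 0"
  by (intro poly_mapping_eqI) (auto simp: mspace_iff lookup_hcomp when_def)

lemma hcomp_add: "hcomp d (f + g) = hcomp d f + hcomp d g"
  by (intro poly_mapping_eqI) (simp add: lookup_add lookup_hcomp when_def)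

lemma hcomp_0 [simp]: "hcomp d 0 = 0"
  by (intro poly_mapping_eqI) (simp add: lookup_hcomp)

lemma hcomp_sum: "hcomp d (sum f A) = (\<Sum>x\<in>A. hcomp d (f x))"
  by (induction A rule: infinite_finite_induct) (simp_all add: hcomp_add)

text \<open>The part of f outside degree \<open>d - e\<close> contributes nothing in degree d.
  Integer degrees cover the case \<open>d < e\<close>, where the component is 0.\<close>

lemma hcomp_mult_homogeneous:
  assumes "g \<in> mdeg_eq e"
  shows "hcomp d (g * f) = g * hcomp (d - e) f"
proof -
  define f' where "f' = f - hcomp (d - e) f"
  have f: "f = hcomp (d - e) f + f'"
    by (simp add: f'_def)
  have "f' \<in> mspace {m. int (mon_degree m) \<noteq> d - e}"
    by (simp add: f'_def mspace_iff lookup_minus lookup_hcomp)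
  then have "g * f' \<in> mspace {m. int (mon_degree m) \<noteq> d}"
    by (rule mspace_mult[OF assms]) (auto simp: mon_degree_add)
  moreover have "g * hcomp (d - e) f \<in> mdeg_eq d"
    by (rule mspace_mult[OF assms hcomp_in_mdeg_eq]) (auto simp: mon_degree_add)
  ultimately have "hcomp d (g * hcomp (d - e) f + g * f') = g * hcomp (d - e) f"
    by (simp add: hcomp_add hcomp_id hcomp_eq_0)
  then show ?thesis
    by (subst f) (simp only: distrib_left)
qed

lemma sum_hcomp:
  assumes "f \<in> mdeg_le d"
  shows "f = (\<Sum>i\<le>d. hcomp (int i) f)"
  using assms by (intro poly_mapping_eqI) (auto simp: lookup_sum lookup_hcomp when_def mspace_iff)

lemma homogeneous_ideal_imp_poly_ideal: "homogeneous_ideal I \<Longrightarrow> poly_ideal I"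
  using poly_ideal_genideal by (auto simp: homogeneous_ideal_def)

text \<open>The polynomials all of whose components lie in I form an ideal: a multiplier can be
  split into its monomials, each of which merely shifts the degree. This ideal contains the
  homogeneous generators, hence I.\<close>

lemma homogeneous_ideal_hcomp:
  fixes I :: "('x::finite, 'k::field) mpoly set"
  assumes "homogeneous_ideal I" "f \<in> I"
  shows "hcomp d f \<in> I"
proof -
  obtain G where G: "\<forall>g\<in>G. \<exists>d. homogeneous_of_degree d g" "I = genideal PR G"
    using assms(1) by (auto simp: homogeneous_ideal_def)
  have I: "poly_ideal I"
    using assms(1) by (rule homogeneous_ideal_imp_poly_ideal)
  define J where "J = {f. \<forall>d. hcomp d f \<in> I}"
  have "hcomp d (g * f) \<in> I" if "f \<in> J" for f g d
  proof -
    have single: "mscale a (Poly_Mapping.single m 1) \<in> mdeg_eq (int (mon_degree m))"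
      for a :: 'k and m :: "'x \<Rightarrow>\<^sub>0 nat"
      by (auto simp: mspace_iff lookup_single when_def)
    have "hcomp d (g * f) = (\<Sum>m\<in>Poly_Mapping.keys g.
        hcomp d (mscale (poly_mapping.lookup g m) (Poly_Mapping.single m 1) * f))"
      by (subst mpoly_expand[of g]) (simp only: sum_distrib_right hcomp_sum)
    also have "\<dots> \<in> I"
      unfolding hcomp_mult_homogeneous[OF single] using that
      by (intro poly_ideal_sum[OF I] poly_idealD(3)[OF I]) (simp add: J_def)
    finally show ?thesis .
  qed
  then have "poly_ideal J"
    using poly_idealD[OF I] by (auto simp: poly_ideal_def J_def hcomp_add)
  moreover have "G \<subseteq> J"
  proof
    fix g assume g: "g \<in> G"
    then obtain e where e: "g \<in> mdeg_eq e"
      using G(1) by (auto simp: homogeneous_iff)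
    have "g \<in> I"
      using g G(2) genideal_superset by blast
    moreover have "hcomp d g = (if d = e then g else 0)" for d
      using e by (auto intro!: hcomp_id hcomp_eq_0 simp: mspace_iff)
    ultimately show "g \<in> J"
      using poly_idealD(1)[OF I] by (simp add: J_def)
  qed
  ultimately have "I \<subseteq> J"
    unfolding G(2) by (rule genideal_least)
  then show ?thesis
    using assms(2) by (auto simp: J_def)
qed

definition graded_hilbert :: "('x::finite, 'k::field) mpoly set \<Rightarrow> nat \<Rightarrow> nat" where
  "graded_hilbert J i = mp.dim (mdeg_eq (int i) :: ('x, 'k) mpoly set) - mp.dim (J \<inter> mdeg_eq (int i))"

lemma dim_ideal_le_mdeg_eq:
  fixes J :: "('x::finite, 'k::field) mpoly set"
  shows "mp.dim (J \<inter> mdeg_eq d) \<le> mp.dim (mdeg_eq d :: ('x, 'k) mpoly set)"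
proof -
  obtain T where T: "finite T" "(mdeg_eq d :: ('x, 'k) mpoly set) \<subseteq> mp.span T"
    using mdeg_eq_finite_span by blast
  show ?thesis
    by (rule mp.dim_mono_finite_span[OF T]) (auto intro: mp.span_base)
qed

text \<open>By homogeneity, bases of the components of I jointly span the part of I of degree at
  most d. Spanning bounds the dimension of that part from above, hence the quotient count from
  below, which is the direction that transfers the growth bound.\<close>

lemma sum_graded_hilbert_le:
  fixes I :: "('x::finite, 'k::field) mpoly set"
  assumes "homogeneous_ideal I"
  shows "(\<Sum>i\<le>d. graded_hilbert I i) \<le> affine_hilbert I d"
proof -
  have "{m :: 'x \<Rightarrow>\<^sub>0 nat. mon_degree m \<le> d} = (\<Union>i\<in>{..d}. {m. int (mon_degree m) = int i})"
    by auto
  then have "card {m :: 'x \<Rightarrow>\<^sub>0 nat. mon_degree m \<le> d} = (\<Sum>i\<le>d. card {m :: 'x \<Rightarrow>\<^sub>0 nat. int (mon_degree m) = int i})"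
    by (simp only:, subst card_UN_disjoint) (auto intro!: finite_mon_degree_eq[of "int _", simplified])
  then have all: "mp.dim (mdeg_le d :: ('x, 'k) mpoly set) = (\<Sum>i\<le>d. mp.dim (mdeg_eq (int i) :: ('x, 'k) mpoly set))"
    by (simp only: dim_mspace finite_mon_degree_le finite_mon_degree_eq)
  have "\<exists>B. finite B \<and> I \<inter> mdeg_eq (int i) \<subseteq> mp.span B \<and> card B = mp.dim (I \<inter> mdeg_eq (int i))" for i
  proof -
    obtain T where T: "finite T" "(mdeg_eq (int i) :: ('x, 'k) mpoly set) \<subseteq> mp.span T"
      using mdeg_eq_finite_span by blast
    show ?thesis
      by (rule mp.finite_basis_obtain[OF T(1) order_trans[OF Int_lower2 T(2)], of I]) blast
  qed
  then have "\<exists>B. \<forall>i. finite (B i) \<and> I \<inter> mdeg_eq (int i) \<subseteq> mp.span (B i) \<and> card (B i) = mp.dim (I \<inter> mdeg_eq (int i))"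
    by (intro choice allI)
  then obtain B where "\<forall>i. finite (B i) \<and> I \<inter> mdeg_eq (int i) \<subseteq> mp.span (B i) \<and> card (B i) = mp.dim (I \<inter> mdeg_eq (int i))"
    ..
  then have B: "\<And>i. finite (B i)" "\<And>i. I \<inter> mdeg_eq (int i) \<subseteq> mp.span (B i)"
    "\<And>i. card (B i) = mp.dim (I \<inter> mdeg_eq (int i))"
    by simp_all
  have "I \<inter> mdeg_le d \<subseteq> mp.span (\<Union>i\<le>d. B i)"
  proof
    fix f assume f: "f \<in> I \<inter> mdeg_le d"
    have "hcomp (int i) f \<in> mp.span (\<Union>i\<le>d. B i)" if "i \<le> d" for i
    proof -
      have "hcomp (int i) f \<in> I \<inter> mdeg_eq (int i)"
        using homogeneous_ideal_hcomp[OF assms] hcomp_in_mdeg_eq f by blast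
      then show ?thesis
        using B(2)[of i] mp.span_mono[of "B i" "\<Union>i\<le>d. B i"] that by blast
    qed
    then have "(\<Sum>i\<le>d. hcomp (int i) f) \<in> mp.span (\<Union>i\<le>d. B i)"
      by (intro mp.span_sum) simp
    then show "f \<in> mp.span (\<Union>i\<le>d. B i)"
      using sum_hcomp[of f d] f by simp
  qed
  then have "mp.dim (I \<inter> mdeg_le d) \<le> card (\<Union>i\<le>d. B i)"
    by (rule mp.dim_le_card) (simp add: B(1))
  also have "\<dots> \<le> (\<Sum>i\<le>d. mp.dim (I \<inter> mdeg_eq (int i)))"
    unfolding B(3)[symmetric] by (rule card_UN_le) simp
  finally show ?thesis
    unfolding affine_hilbert_def graded_hilbert_def all
    by (subst sum_subtractf_nat[OF dim_ideal_le_mdeg_eq]) (rule diff_le_mono2)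
qed

section \<open>Dimensions in the quotient ring\<close>

lemma coset_eq_iff:
  fixes I :: "('x::finite, 'k::field) mpoly set"
  assumes "poly_ideal I"
  shows "I +>\<^bsub>PR\<^esub> f = I +>\<^bsub>PR\<^esub> g \<longleftrightarrow> f - g \<in> I"
proof -
  interpret ideal I PR using assms by (rule poly_ideal_imp_ideal_PR)
  have mem: "h \<in> I +>\<^bsub>PR\<^esub> g \<longleftrightarrow> h - g \<in> I" for g h :: "('x, 'k) mpoly"
    by (auto simp: a_r_coset_def' intro: bexI[of _ "h - g"])
  show ?thesis
  proof
    assume "I +>\<^bsub>PR\<^esub> f = I +>\<^bsub>PR\<^esub> g"
    then show "f - g \<in> I"
      using mem[of f f] mem[of f g] poly_idealD(1)[OF assms] by simp
  next
    assume *: "f - g \<in> I"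
    have "h - f \<in> I \<longleftrightarrow> h - g \<in> I" for h :: "('x, 'k) mpoly"
      using mp.subspace_add[OF subspace_poly_ideal[OF assms] _ *, of "h - f"]
        mp.subspace_diff[OF subspace_poly_ideal[OF assms] _ *, of "h - g"] by auto
    then show "I +>\<^bsub>PR\<^esub> f = I +>\<^bsub>PR\<^esub> g"
      unfolding set_eq_iff mem by blast
  qed
qed

lemma subfield_constants: "subfield (range (Poly_Mapping.single 0)) (PR :: ('x::finite, 'k::field) mpoly ring)"
proof -
  interpret K: field "ring_of_type_algebra :: 'k ring" by (rule field_from_type_algebra)
  interpret R: cring "PR :: ('x, 'k) mpoly ring" by (rule cring_PR)
  have "ring_hom_ring (ring_of_type_algebra :: 'k ring) (PR :: ('x, 'k) mpoly ring) (Poly_Mapping.single 0)"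
    by (intro ring_hom_ringI K.ring_axioms R.ring_axioms)
      (simp_all add: ring_of_type_algebra_def single_add mult_single)
  then have "subfield (Poly_Mapping.single 0 ` carrier (ring_of_type_algebra :: 'k ring)) (PR :: ('x, 'k) mpoly ring)"
    by (rule ring_hom_ring.img_is_subfield(2)) (auto intro: K.carrier_is_subfield)
  then show ?thesis
    by (simp add: ring_of_type_algebra_def)
qed

lemma subfield_quot_scalars:
  fixes I :: "('x::finite, 'k::field) mpoly set"
  assumes "poly_ideal I" "1 \<notin> I"
  shows "subfield (quot_scalars I) (PR Quot I)"
proof -
  interpret ideal I PR using assms(1) by (rule poly_ideal_imp_ideal_PR)
  interpret h: ring_hom_ring PR "PR Quot I" "(+>\<^bsub>PR\<^esub>) I" by (rule rcos_ring_hom_ring)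
  have "\<one>\<^bsub>PR Quot I\<^esub> \<noteq> \<zero>\<^bsub>PR Quot I\<^esub>"
    using coset_eq_iff[OF assms(1), of 1 0] assms(2) h.hom_one h.hom_zero by simp
  then have "subfield ((+>\<^bsub>PR\<^esub>) I ` range (Poly_Mapping.single 0)) (PR Quot I)"
    by (intro h.img_is_subfield(2) subfield_constants)
  then show ?thesis
    by (simp add: quot_scalars_def image_image)
qed

text \<open>\<open>ring.dimension\<close> is built from line extensions, so the proof adds the
  elements of C one at a time. Two cosets agree exactly if p agrees on their representatives, so
  independence of the images under p keeps each extension proper.\<close>

lemma quot_dimension_span:
  fixes I :: "('x::finite, 'k::field) mpoly set" and p :: "('x, 'k) mpoly \<Rightarrow> ('x, 'k) mpoly"
  assumes I: "poly_ideal I"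
    and p: "Vector_Spaces.linear mscale mscale p" "\<And>f. p f = 0 \<longleftrightarrow> f \<in> I"
    and C: "finite C" "inj_on p C" "mp.independent (p ` C)"
  shows "ring.dimension (PR Quot I) (card C) (quot_scalars I) ((+>\<^bsub>PR\<^esub>) I ` mp.span C)"
  using C
proof (induction C rule: finite_induct)
  interpret ideal I PR using I by (rule poly_ideal_imp_ideal_PR)
  interpret h: ring_hom_ring PR "PR Quot I" "(+>\<^bsub>PR\<^esub>) I" by (rule rcos_ring_hom_ring)
  case empty
  show ?case
    using h.S.dimension.zero_dim h.hom_zero by simp
next
  interpret ideal I PR using I by (rule poly_ideal_imp_ideal_PR)
  interpret h: ring_hom_ring PR "PR Quot I" "(+>\<^bsub>PR\<^esub>) I" by (rule rcos_ring_hom_ring)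
  interpret p: Vector_Spaces.linear mscale mscale p by fact
  let ?h = "(+>\<^bsub>PR\<^esub>) I"
  case (insert c C)
  have pc: "p c \<notin> mp.span (p ` C)" and ind: "mp.independent (p ` C)"
    using insert.prems insert.hyps by (auto simp: mp.independent_insert split: if_splits)
  have dim: "h.S.dimension (card C) (quot_scalars I) (?h ` mp.span C)"
    using insert.IH insert.prems(1) ind by simp
  have "?h c \<notin> ?h ` mp.span C"
  proof
    assume "?h c \<in> ?h ` mp.span C"
    then obtain y where y: "y \<in> mp.span C" "c - y \<in> I"
      using coset_eq_iff[OF I] by blast
    then have "p c = p y"
      using p(2)[of "c - y"] by (simp add: p.diff)
    then show False
      using pc y(1) unfolding p.span_image by blast
  qed
  moreover have "?h ` mp.span (insert c C) = h.S.line_extension (quot_scalars I) (?h c) (?h ` mp.span C)"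
  proof (intro Set.set_eqI)
    fix u
    have hom: "?h (mscale k c + y) = (?h (Poly_Mapping.single 0 k) \<otimes>\<^bsub>PR Quot I\<^esub> ?h c) \<oplus>\<^bsub>PR Quot I\<^esub> ?h y" for k y
      using h.hom_add[of "mscale k c" y] h.hom_mult[of "Poly_Mapping.single 0 k" c] by (simp add: mscale_def)
    have "u \<in> ?h ` mp.span (insert c C) \<longleftrightarrow> (\<exists>k. \<exists>y\<in>mp.span C. u = ?h (mscale k c + y))"
    proof
      assume "u \<in> ?h ` mp.span (insert c C)"
      then obtain x k where x: "u = ?h x" "x - mscale k c \<in> mp.span C"
        unfolding mp.span_insert by blast
      then show "\<exists>k. \<exists>y\<in>mp.span C. u = ?h (mscale k c + y)"
        by (intro exI[of _ k] bexI[of _ "x - mscale k c"]) simp_all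
    next
      assume "\<exists>k. \<exists>y\<in>mp.span C. u = ?h (mscale k c + y)"
      then obtain k y where y: "y \<in> mp.span C" "u = ?h (mscale k c + y)" by blast
      have "mscale k c + y \<in> mp.span (insert c C)"
        unfolding mp.span_insert using y(1) by (auto intro: exI[of _ k])
      then show "u \<in> ?h ` mp.span (insert c C)"
        using y(2) by blast
    qed
    then show "u \<in> ?h ` mp.span (insert c C) \<longleftrightarrow> u \<in> h.S.line_extension (quot_scalars I) (?h c) (?h ` mp.span C)"
      unfolding h.S.line_extension_mem_iff quot_scalars_def hom by blast
  qed
  ultimately show ?case
    using h.S.dimension.Suc_dim[OF _ _ dim, of "?h c"] h.hom_closed[of c] insert.hyps by simp
qed

text \<open>A basis of the projected component lifts to homogeneous polynomials of degree i, and the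
  cosets of their span fill \<open>quot_component I i\<close>; rank-nullity for p then gives the
  difference.\<close>

lemma hilbert_function_eq_graded_hilbert:
  fixes I :: "('x::finite, 'k::field) mpoly set"
  assumes I: "poly_ideal I" and "1 \<notin> I"
  shows "hilbert_function I i = graded_hilbert I i"
proof -
  interpret ideal I PR using I by (rule poly_ideal_imp_ideal_PR)
  interpret h: ring_hom_ring PR "PR Quot I" "(+>\<^bsub>PR\<^esub>) I" by (rule rcos_ring_hom_ring)
  let ?V = "mdeg_eq (int i) :: ('x, 'k) mpoly set"
  obtain p :: "('x, 'k) mpoly \<Rightarrow> ('x, 'k) mpoly" where p: "Vector_Spaces.linear mscale mscale p" "\<And>f. p f = 0 \<longleftrightarrow> f \<in> I"
    using poly_ideal_projection[OF I] by blast
  interpret p: Vector_Spaces.linear mscale mscale p by fact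
  obtain T where T: "finite T" "?V \<subseteq> mp.span T"
    using mdeg_eq_finite_span by blast
  obtain B where B: "finite B" "B \<subseteq> p ` ?V" "mp.independent B" "p ` ?V \<subseteq> mp.span B" "card B = mp.dim (p ` ?V)"
    by (rule mp.finite_basis_obtain[OF linear_image_finite_span[OF p(1) T]])
  obtain C where C: "C \<subseteq> ?V" "inj_on p C" "p ` C = B"
    using subset_image_inj[of B p ?V] B(2) by blast
  have fC: "finite C" and cC: "card C = card B"
    using C B(1) finite_image_iff card_image by metis+
  have spanC: "mp.span C \<subseteq> ?V"
    by (rule mp.span_minimal[OF C(1) subspace_mspace])
  have "(+>\<^bsub>PR\<^esub>) I ` ?V = (+>\<^bsub>PR\<^esub>) I ` mp.span C"
  proof
    show "(+>\<^bsub>PR\<^esub>) I ` ?V \<subseteq> (+>\<^bsub>PR\<^esub>) I ` mp.span C"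
    proof (intro image_subsetI)
      fix f assume "f \<in> ?V"
      then have "p f \<in> p ` mp.span C"
        using B(4) C(3) p.span_image[of C] by blast
      then obtain g where "g \<in> mp.span C" "p f = p g" by blast
      then show "I +>\<^bsub>PR\<^esub> f \<in> (+>\<^bsub>PR\<^esub>) I ` mp.span C"
        using p(2)[of "f - g"] coset_eq_iff[OF I, of f g] by (auto simp: p.diff)
    qed
  qed (use spanC in blast)
  moreover have "quot_component I i = (+>\<^bsub>PR\<^esub>) I ` ?V"
    by (simp add: quot_component_def homogeneous_iff)
  ultimately have "h.S.dimension (card C) (quot_scalars I) (quot_component I i)"
    using quot_dimension_span[OF I p fC C(2)] C(3) B(3) by simp
  then have "hilbert_function I i = mp.dim (p ` ?V)"
    using h.S.dimI[OF subfield_quot_scalars[OF assms]] cC B(5) by (simp add: hilbert_function_def over_def)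
  moreover have "{f \<in> ?V. p f = 0} = I \<inter> ?V"
    unfolding p(2) by blast
  then have "mp.dim ?V = mp.dim (I \<inter> ?V) + mp.dim (p ` ?V)"
    using mpp.rank_nullity_subspace[OF p(1) subspace_mspace T] by simp
  ultimately show ?thesis
    by (simp add: graded_hilbert_def)
qed

section \<open>Hilbert functions from graded free resolutions\<close>

text \<open>Elements of free modules are functions vanishing beyond the rank instead of vectors, so
  that free modules of all ranks lie in one vector space.\<close>

definition fscale :: "'k \<Rightarrow> (nat \<Rightarrow> ('x::finite, 'k::field) mpoly) \<Rightarrow> nat \<Rightarrow> ('x, 'k) mpoly" where
  "fscale a v = (\<lambda>i. mscale a (v i))"

lemma fscale_apply [simp]: "fscale a v i = mscale a (v i)"
  by (simp add: fscale_def)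

interpretation fs: vector_space fscale
  by unfold_locales (simp_all add: fun_eq_iff mp.scale_right_distrib mp.scale_left_distrib)

interpretation fsp: vector_space_pair fscale fscale
  by unfold_locales

interpretation fmp: vector_space_pair fscale mscale
  by unfold_locales

lemma sum_fun_apply: "(\<Sum>x\<in>A. f x) i = (\<Sum>x\<in>A. f x i)"
  for f :: "'a \<Rightarrow> 'b \<Rightarrow> 'c::comm_monoid_add"
  by (induction A rule: infinite_finite_induct) simp_all

definition num_monomials :: "'x::finite itself \<Rightarrow> int \<Rightarrow> nat" where
  "num_monomials _ d = card {m :: 'x \<Rightarrow>\<^sub>0 nat. int (mon_degree m) = d}"

text \<open>The degree d component of the free module with the shifts D, as a space of functions vanishing
  beyond the length of D.\<close>
definition free_component :: "int list \<Rightarrow> int \<Rightarrow> (nat \<Rightarrow> ('x::finite, 'k::field) mpoly) set" where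
  "free_component D d = {v. (\<forall>q<length D. v q \<in> mdeg_eq (d - D ! q)) \<and> (\<forall>q\<ge>length D. v q = 0)}"

lemma free_componentD: "v \<in> free_component D d \<Longrightarrow> q < length D \<Longrightarrow> v q \<in> mdeg_eq (d - D ! q)"
  and free_component_outside: "v \<in> free_component D d \<Longrightarrow> length D \<le> q \<Longrightarrow> v q = 0"
  by (auto simp: free_component_def)

lemma subspace_free_component: "fs.subspace (free_component D d)"
  by (intro fs.subspaceI)
    (auto simp: free_component_def mp.subspace_add[OF subspace_mspace] mp.subspace_scale[OF subspace_mspace]
      mp.subspace_0[OF subspace_mspace])

definition unit_monomial :: "nat \<times> ('x::finite \<Rightarrow>\<^sub>0 nat) \<Rightarrow> nat \<Rightarrow> ('x, 'k::field) mpoly" where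
  "unit_monomial qm = (\<lambda>j. if j = fst qm then Poly_Mapping.single (snd qm) 1 else 0)"

definition free_monomials :: "int list \<Rightarrow> int \<Rightarrow> (nat \<times> ('x::finite \<Rightarrow>\<^sub>0 nat)) set" where
  "free_monomials D d = (SIGMA q:{..<length D}. {m. int (mon_degree m) = d - D ! q})"

lemma finite_free_monomials: "finite (free_monomials D d)"
  unfolding free_monomials_def by (intro finite_SigmaI finite_mon_degree_eq) simp

lemma card_free_monomials:
  "card (free_monomials D d :: (nat \<times> ('x::finite \<Rightarrow>\<^sub>0 nat)) set) = (\<Sum>q<length D. num_monomials TYPE('x) (d - D ! q))"
  unfolding free_monomials_def num_monomials_def by (subst card_SigmaI) (auto intro: finite_mon_degree_eq)

lemma lookup_sum_unit_monomial:
  assumes "finite A"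
  shows "poly_mapping.lookup ((\<Sum>qm\<in>A. fscale (u qm) (unit_monomial qm)) q) m = (if (q, m) \<in> A then u (q, m) else 0)"
proof -
  have "poly_mapping.lookup ((\<Sum>qm\<in>A. fscale (u qm) (unit_monomial qm)) q) m =
      (\<Sum>qm\<in>A. if qm = (q, m) then u qm else 0)"
    unfolding sum_fun_apply lookup_sum
    by (intro sum.cong) (auto simp: unit_monomial_def lookup_single when_def)
  then show ?thesis
    using assms by simp
qed

lemma free_component_subset_span:
  "free_component D d \<subseteq> fs.span (unit_monomial ` free_monomials D d :: (nat \<Rightarrow> ('x::finite, 'k::field) mpoly) set)"
proof
  fix v :: "nat \<Rightarrow> ('x, 'k) mpoly" assume v: "v \<in> free_component D d"
  have "v = (\<Sum>qm\<in>free_monomials D d. fscale (poly_mapping.lookup (v (fst qm)) (snd qm)) (unit_monomial qm))"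
  proof (intro ext poly_mapping_eqI)
    fix q m
    have "poly_mapping.lookup (v q) m = 0" if "(q, m) \<notin> free_monomials D d"
      using that free_componentD[OF v, of q] free_component_outside[OF v, of q]
      by (cases "q < length D") (auto simp: free_monomials_def mspace_iff)
    then show "poly_mapping.lookup (v q) m = poly_mapping.lookup
        ((\<Sum>qm\<in>free_monomials D d. fscale (poly_mapping.lookup (v (fst qm)) (snd qm)) (unit_monomial qm)) q) m"
      unfolding lookup_sum_unit_monomial[OF finite_free_monomials] by simp
  qed
  moreover have "(\<Sum>qm\<in>free_monomials D d. fscale (poly_mapping.lookup (v (fst qm)) (snd qm)) (unit_monomial qm))
      \<in> fs.span (unit_monomial ` free_monomials D d)"
    by (intro fs.span_sum fs.span_scale fs.span_base) simp
  ultimately show "v \<in> fs.span (unit_monomial ` free_monomials D d)"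
    by simp
qed

lemma dim_free_component:
  "fs.dim (free_component D d :: (nat \<Rightarrow> ('x::finite, 'k::field) mpoly) set) = (\<Sum>q<length D. num_monomials TYPE('x) (d - D ! q))"
proof -
  let ?e = "unit_monomial :: nat \<times> ('x \<Rightarrow>\<^sub>0 nat) \<Rightarrow> nat \<Rightarrow> ('x, 'k) mpoly"
  let ?M = "free_monomials D d :: (nat \<times> ('x \<Rightarrow>\<^sub>0 nat)) set"
  have inj: "inj_on ?e ?M"
  proof (rule inj_onI)
    fix a b assume "?e a = ?e b"
    then have "poly_mapping.lookup (?e a (fst a)) (snd a) = poly_mapping.lookup (?e b (fst a)) (snd a)" by simp
    then show "a = b"
      by (auto simp: unit_monomial_def lookup_single when_def prod_eq_iff split: if_splits)
  qed
  have "fs.independent (?e ` ?M)"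
  proof (rule fs.independent_if_scalars_zero)
    fix u x assume sum: "(\<Sum>x\<in>?e ` ?M. fscale (u x) x) = 0" and "x \<in> ?e ` ?M"
    then obtain qm where qm: "qm \<in> ?M" "x = ?e qm" by blast
    have "(\<Sum>qm\<in>?M. fscale (u (?e qm)) (?e qm)) = 0"
      using sum by (simp add: sum.reindex[OF inj])
    then have "poly_mapping.lookup ((\<Sum>qm\<in>?M. fscale (u (?e qm)) (?e qm)) (fst qm)) (snd qm) = 0" by simp
    then show "u x = 0"
      using qm unfolding lookup_sum_unit_monomial[OF finite_free_monomials] by simp
  qed (simp add: finite_free_monomials)
  moreover have "?e ` ?M \<subseteq> free_component D d"
    by (auto simp: free_component_def free_monomials_def unit_monomial_def mspace_iff lookup_single when_def)
  ultimately have "card (?e ` ?M) = fs.dim (free_component D d :: (nat \<Rightarrow> ('x, 'k) mpoly) set)"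
    using free_component_subset_span by (intro fs.basis_card_eq_dim)
  then show ?thesis
    using card_image[OF inj] card_free_monomials by metis
qed

section \<open>Degree-preserving matrices on graded components\<close>

definition matmap :: "('x::finite, 'k::field) mpoly mat \<Rightarrow> (nat \<Rightarrow> ('x, 'k) mpoly) \<Rightarrow> nat \<Rightarrow> ('x, 'k) mpoly" where
  "matmap A v = (\<lambda>p. if p < dim_row A then \<Sum>q<dim_col A. A $$ (p, q) * v q else 0)"

lemma linear_matmap: "Vector_Spaces.linear fscale fscale (matmap A)"
  by unfold_locales
    (auto simp: matmap_def fun_eq_iff distrib_left sum.distrib mp.scale_sum_right mscale_mult[symmetric])

lemma linear_matmap_apply: "Vector_Spaces.linear fscale mscale (\<lambda>v. matmap A v p)"
  by unfold_locales
    (auto simp: matmap_def fun_eq_iff distrib_left sum.distrib mp.scale_sum_right mscale_mult[symmetric])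

lemma mult_mat_vec_index:
  assumes "w \<in> carrier_vec (dim_col A)" "p < dim_row A"
  shows "(A *\<^sub>v w) $ p = (\<Sum>q<dim_col A. A $$ (p, q) * w $ q)"
  using assms by (auto simp: scalar_prod_def atLeast0LessThan intro!: sum.cong)

lemma mult_mat_vec_matmap: "A *\<^sub>v vec (dim_col A) v = vec (dim_row A) (matmap A v)"
  by (intro eq_vecI) (auto simp: mult_mat_vec_index matmap_def simp del: index_mult_mat_vec)

lemma matmap_eq_0_iff: "matmap A v = 0 \<longleftrightarrow> vec (dim_col A) v \<in> mat_kernel A"
proof -
  have "matmap A v = 0 \<longleftrightarrow> vec (dim_row A) (matmap A v) = 0\<^sub>v (dim_row A)"
    by (auto simp: vec_eq_iff fun_eq_iff matmap_def)
  then show ?thesis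
    by (simp add: mat_kernel_def mult_mat_vec_matmap)
qed

definition graded_matrix :: "int list \<Rightarrow> int list \<Rightarrow> ('x::finite, 'k::field) mpoly mat \<Rightarrow> bool" where
  "graded_matrix E D A \<longleftrightarrow> A \<in> carrier_mat (length E) (length D) \<and>
     (\<forall>p<length E. \<forall>q<length D. A $$ (p, q) \<in> mdeg_eq (D ! q - E ! p))"

lemma matmap_free_component:
  assumes A: "graded_matrix E D A" and v: "v \<in> free_component D d"
  shows "matmap A v \<in> free_component E d"
proof -
  have "A $$ (p, q) * v q \<in> mdeg_eq (d - E ! p)" if "p < length E" "q < length D" for p q
    using A that by (intro mspace_mult[OF _ free_componentD[OF v that(2)]]) (auto simp: graded_matrix_def mon_degree_add)
  then have "(\<Sum>q<length D. A $$ (p, q) * v q) \<in> mdeg_eq (d - E ! p)" if "p < length E" for p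
    using that by (intro mp.subspace_sum[OF subspace_mspace]) auto
  then show ?thesis
    using A by (auto simp: free_component_def graded_matrix_def matmap_def)
qed

text \<open>A degree-preserving matrix commutes with taking the component of degree d, where the
  degree in each coordinate is corrected by the shift.\<close>

lemma matmap_homogenize:
  fixes A :: "('x::finite, 'k::field) mpoly mat" and w :: "('x, 'k) mpoly vec" and d :: int
  assumes A: "graded_matrix E D A" and w: "w \<in> carrier_vec (length D)"
  defines "w' \<equiv> \<lambda>q. if q < length D then hcomp (d - D ! q) (w $ q) else 0"
  shows "w' \<in> free_component D d"
    and "p < length E \<Longrightarrow> matmap A w' p = hcomp (d - E ! p) ((A *\<^sub>v w) $ p)"
proof -
  show "w' \<in> free_component D d"
    by (simp add: w'_def free_component_def hcomp_in_mdeg_eq)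
  assume p: "p < length E"
  have dim: "dim_row A = length E" "dim_col A = length D"
    using A by (auto simp: graded_matrix_def)
  have "hcomp (d - E ! p) (A $$ (p, q) * w $ q) = A $$ (p, q) * w' q" if "q < length D" for q
    using A p that by (subst hcomp_mult_homogeneous[of _ "D ! q - E ! p"]) (auto simp: graded_matrix_def w'_def)
  then show "matmap A w' p = hcomp (d - E ! p) ((A *\<^sub>v w) $ p)"
    using p w by (simp add: matmap_def dim mult_mat_vec_index hcomp_sum del: index_mult_mat_vec)
qed

text \<open>Exactness on all vectors restricts to each degree: if v is homogeneous, any preimage of
  v may be replaced by its component of degree d.\<close>

lemma matmap_kernel_component:
  assumes A: "graded_matrix E D A" and B: "graded_matrix D C B"
    and exact: "mat_kernel A = {B *\<^sub>v w | w. w \<in> carrier_vec (length C)}"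
  shows "{v \<in> free_component D d. matmap A v = 0} = matmap B ` free_component C d"
proof (intro Set.equalityI subsetI)
  have dim: "dim_col A = length D" "dim_row B = length D" "dim_col B = length C"
    using A B by (auto simp: graded_matrix_def)
  fix v
  {
    assume "v \<in> {v \<in> free_component D d. matmap A v = 0}"
    then have v: "v \<in> free_component D d" "vec (length D) v \<in> mat_kernel A"
      by (auto simp: matmap_eq_0_iff dim)
    then obtain w where w: "w \<in> carrier_vec (length C)" "vec (length D) v = B *\<^sub>v w"
      using exact by blast
    define w' where "w' = (\<lambda>q. if q < length C then hcomp (d - C ! q) (w $ q) else 0)"
    have "matmap B w' p = v p" for p
    proof (cases "p < length D")
      case True
      then have "(B *\<^sub>v w) $ p = v p"
        using w(2)[symmetric] by simp
      then show ?thesis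
        using matmap_homogenize(2)[OF B w(1) True, of d] hcomp_id[OF free_componentD[OF v(1) True]]
        by (simp add: w'_def)
    next
      case False
      then show ?thesis
        using free_component_outside[OF v(1), of p] by (simp add: matmap_def dim)
    qed
    then have "v = matmap B w'" by (simp add: fun_eq_iff)
    then show "v \<in> matmap B ` free_component C d"
      using matmap_homogenize(1)[OF B w(1), of d] w'_def by blast
  next
    assume "v \<in> matmap B ` free_component C d"
    then obtain w where w: "w \<in> free_component C d" "v = matmap B w" by blast
    have eq: "vec (length D) v = B *\<^sub>v vec (length C) w"
      using mult_mat_vec_matmap[of B w] w(2) by (simp add: dim)
    have "vec (length D) v \<in> mat_kernel A"
      unfolding exact by (intro CollectI exI conjI, rule eq, rule vec_carrier)
    then show "v \<in> {v \<in> free_component D d. matmap A v = 0}"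
      using matmap_free_component[OF B w(1)] w(2) by (simp add: matmap_eq_0_iff dim)
  }
qed

text \<open>In degree d, rank-nullity expresses each dimension as the sum of two consecutive kernel
  dimensions, so the alternating sum telescopes. Truncation after \<open>Suc m\<close> leaves the
  error term \<open>ker m\<close>, which vanishes at \<open>m = L\<close> because the module in
  position \<open>Suc L\<close> is zero.\<close>

lemma graded_free_resolution_hilbert:
  fixes I :: "('x::finite, 'k::field) mpoly set"
  assumes res: "graded_free_resolution I D \<phi>" and len: "\<And>i. i > L \<Longrightarrow> D i = []"
  shows "int (graded_hilbert I d) = (\<Sum>i\<le>L. (-1) ^ i * (\<Sum>q<length (D i). int (num_monomials TYPE('x) (int d - D i ! q))))"
proof -
  have gr: "graded_matrix (D i) (D (Suc i)) (\<phi> i)" for i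
    using res by (simp add: graded_free_resolution_def graded_matrix_def homogeneous_iff)
  have D0: "D 0 = [0]"
    using res by (simp add: graded_free_resolution_def)
  let ?F = "\<lambda>i. free_component (D i) (int d) :: (nat \<Rightarrow> ('x, 'k) mpoly) set"
  define a where "a i = (\<Sum>q<length (D i). int (num_monomials TYPE('x) (int d - D i ! q)))" for i
  define K where "K i = {v \<in> ?F (Suc i). matmap (\<phi> i) v = 0}" for i
  define ker where "ker i = int (fs.dim (K i))" for i
  have a: "int (fs.dim (?F i)) = a i" for i
    by (simp add: a_def dim_free_component)
  have fin: "finite (unit_monomial ` free_monomials D' (int d) :: (nat \<Rightarrow> ('x, 'k) mpoly) set)" for D'
    by (simp add: finite_free_monomials)
  have K: "K i = matmap (\<phi> (Suc i)) ` ?F (Suc (Suc i))" for i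
    unfolding K_def
    by (rule matmap_kernel_component[OF gr gr]) (use res in \<open>simp add: graded_free_resolution_def\<close>)
  have step: "a (Suc (Suc i)) = ker (Suc i) + ker i" for i
    using fsp.rank_nullity_subspace[OF linear_matmap subspace_free_component fin free_component_subset_span, of "D (Suc (Suc i))" "\<phi> (Suc i)"]
    unfolding K[of i, symmetric] K_def[of "Suc i", symmetric] a[symmetric] ker_def by simp
  have I: "I \<inter> mdeg_eq (int d) = (\<lambda>v. matmap (\<phi> 0) v 0) ` ?F 1"
  proof (intro Set.equalityI subsetI)
    have I_eq: "I = {(\<phi> 0 *\<^sub>v v) $ 0 | v. v \<in> carrier_vec (length (D 1))}"
      using res by (simp add: graded_free_resolution_def)
    have dim: "dim_row (\<phi> 0) = 1" "dim_col (\<phi> 0) = length (D 1)"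
      using gr[of 0] by (auto simp: graded_matrix_def D0)
    fix f
    {
      assume f: "f \<in> I \<inter> mdeg_eq (int d)"
      then obtain w where w: "w \<in> carrier_vec (length (D 1))" "f = (\<phi> 0 *\<^sub>v w) $ 0"
        using I_eq by blast
      have "hcomp (int d) f = f"
        using f by (intro hcomp_id) blast
      define w' where "w' = (\<lambda>q. if q < length (D (Suc 0)) then hcomp (int d - D (Suc 0) ! q) (w $ q) else 0)"
      have "matmap (\<phi> 0) w' 0 = f"
        using matmap_homogenize(2)[OF gr[of 0], of w 0 "int d"] w \<open>hcomp (int d) f = f\<close> by (simp add: D0 w'_def)
      moreover have "w' \<in> ?F 1"
        using matmap_homogenize(1)[OF gr[of 0], of w "int d"] w(1) by (simp add: w'_def)
      ultimately show "f \<in> (\<lambda>v. matmap (\<phi> 0) v 0) ` ?F 1"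
        by blast
    next
      assume "f \<in> (\<lambda>v. matmap (\<phi> 0) v 0) ` ?F 1"
      then obtain v where v: "v \<in> ?F 1" "f = matmap (\<phi> 0) v 0" by blast
      have "f = (\<phi> 0 *\<^sub>v vec (length (D 1)) v) $ 0"
        using mult_mat_vec_matmap[of "\<phi> 0" v] v(2) dim by simp
      then have "f \<in> I"
        unfolding I_eq by fastforce
      moreover have "f \<in> mdeg_eq (int d)"
        using free_componentD[OF matmap_free_component[OF gr[of 0], of v "int d"], of 0] v by (simp add: D0)
      ultimately show "f \<in> I \<inter> mdeg_eq (int d)" by blast
    }
  qed
  have K0: "K 0 = {v \<in> ?F 1. matmap (\<phi> 0) v 0 = 0}"
  proof -
    have "matmap (\<phi> 0) v = 0 \<longleftrightarrow> matmap (\<phi> 0) v 0 = 0" for v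
      using gr[of 0] by (auto simp: graded_matrix_def D0 matmap_def fun_eq_iff)
    then show ?thesis
      by (simp add: K_def)
  qed
  have step0: "a 1 = ker 0 + int (mp.dim (I \<inter> mdeg_eq (int d)))"
    using fmp.rank_nullity_subspace[OF linear_matmap_apply subspace_free_component fin free_component_subset_span, of "D 1" "\<phi> 0" 0]
    unfolding I[symmetric] K0[symmetric] a[symmetric] ker_def by simp
  have "mp.dim (mdeg_eq (int d) :: ('x, 'k) mpoly set) = num_monomials TYPE('x) (int d)"
    by (simp only: dim_mspace[OF finite_mon_degree_eq] num_monomials_def)
  then have H: "int (graded_hilbert I d) = a 0 - int (mp.dim (I \<inter> mdeg_eq (int d)))"
    using dim_ideal_le_mdeg_eq[of I "int d"] by (simp add: graded_hilbert_def a_def D0 of_nat_diff)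
  have partial: "int (graded_hilbert I d) = (\<Sum>i\<le>Suc m. (-1) ^ i * a i) + (-1) ^ m * ker m" for m
  proof (induction m)
    case 0
    show ?case
      using H step0 by simp
  next
    case (Suc m)
    then show ?case
      using step[of m] by (simp add: algebra_simps)
  qed
  have "K L = {0}"
    using len[of "Suc L"] by (auto simp: K_def free_component_def matmap_def fun_eq_iff)
  then have "int (graded_hilbert I d) = (\<Sum>i\<le>Suc L. (-1) ^ i * a i)"
    using partial[of L] fs.dim_zero_space by (simp add: ker_def)
  also have "\<dots> = (\<Sum>i\<le>L. (-1) ^ i * a i)"
    using len[of "Suc L"] by (simp add: a_def)
  finally show ?thesis
    by (simp add: a_def)
qed

section \<open>The Hilbert series of a minimal resolution\<close>

text \<open>The polynomials supported in positive degree form an ideal containing the variables. In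
  particular 1 lies outside, which is what both minimality and the properness of I rest on.\<close>

lemma irrelevant_ideal_constant_term:
  assumes "f \<in> (irrelevant_ideal :: ('x::finite, 'k::field) mpoly set)"
  shows "poly_mapping.lookup f 0 = 0"
proof -
  let ?M = "{m. mon_degree m \<ge> 1} :: ('x \<Rightarrow>\<^sub>0 nat) set"
  have "poly_ideal (mspace ?M :: ('x, 'k) mpoly set)"
    unfolding poly_ideal_def
  proof (intro conjI ballI allI)
    fix f g :: "('x, 'k) mpoly" assume f: "f \<in> mspace ?M"
    have "g \<in> mspace UNIV"
      by (simp add: mspace_def)
    then show "g * f \<in> mspace ?M"
      by (rule mspace_mult[OF _ f]) (simp add: mon_degree_add)
  qed (auto intro: mp.subspace_add[OF subspace_mspace] mp.subspace_0[OF subspace_mspace])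
  moreover have "range indeterminate \<subseteq> (mspace ?M :: ('x, 'k) mpoly set)"
  proof (intro image_subsetI)
    fix x :: 'x
    have "1 \<le> mon_degree (Poly_Mapping.single x 1 :: 'x \<Rightarrow>\<^sub>0 nat)"
      using lookup_le_mon_degree[of "Poly_Mapping.single x 1 :: 'x \<Rightarrow>\<^sub>0 nat" x] by simp
    then show "(indeterminate x :: ('x, 'k) mpoly) \<in> mspace ?M"
      by (auto simp: indeterminate_def mspace_def)
  qed
  ultimately have "irrelevant_ideal \<subseteq> (mspace ?M :: ('x, 'k) mpoly set)"
    unfolding irrelevant_ideal_def by (rule genideal_least)
  then show ?thesis
    using assms by (auto simp: mspace_iff)
qed

text \<open>A zero column of a differential would put a basis vector into the image of the next
  differential, which minimality forbids.\<close>
lemma minimal_resolution_shifts_nonneg: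
  fixes I :: "('x::finite, 'k::field) mpoly set"
  assumes res: "minimal_graded_free_resolution I D \<phi>"
  shows "q < length (D i) \<Longrightarrow> D i ! q \<ge> 0"
proof (induction i arbitrary: q)
  case 0
  then show ?case
    using res by (simp add: minimal_graded_free_resolution_def graded_free_resolution_def)
next
  case (Suc i)
  have gr: "graded_matrix (D i) (D (Suc i)) (\<phi> i)" for i
    using res by (simp add: minimal_graded_free_resolution_def graded_free_resolution_def graded_matrix_def homogeneous_iff)
  have exact: "mat_kernel (\<phi> i) = {\<phi> (Suc i) *\<^sub>v v | v. v \<in> carrier_vec (length (D (Suc (Suc i))))}"
    using res by (simp add: minimal_graded_free_resolution_def graded_free_resolution_def)
  have min: "\<phi> i $$ (p, q) \<in> irrelevant_ideal" if "p < length (D i)" "q < length (D (Suc i))" for i p q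
    using res that by (simp add: minimal_graded_free_resolution_def)
  have dim: "dim_row (\<phi> i) = length (D i)" "dim_col (\<phi> i) = length (D (Suc i))" for i
    using gr[of i] by (auto simp: graded_matrix_def)
  have irr: "poly_ideal (irrelevant_ideal :: ('x, 'k) mpoly set)"
    unfolding irrelevant_ideal_def by (rule poly_ideal_genideal)
  have "\<exists>p<length (D i). \<phi> i $$ (p, q) \<noteq> 0"
  proof (rule ccontr)
    assume zero: "\<not> (\<exists>p<length (D i). \<phi> i $$ (p, q) \<noteq> 0)"
    define e where "e = (\<lambda>j. if j = q then 1 else 0 :: ('x, 'k) mpoly)"
    have "matmap (\<phi> i) e = 0"
      using zero by (auto simp: matmap_def e_def dim fun_eq_iff intro!: sum.neutral)
    then obtain w where w: "w \<in> carrier_vec (length (D (Suc (Suc i))))" "vec (length (D (Suc i))) e = \<phi> (Suc i) *\<^sub>v w"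
      using exact by (auto simp: matmap_eq_0_iff dim)
    have "1 = (\<phi> (Suc i) *\<^sub>v w) $ q"
      unfolding w(2)[symmetric] using Suc.prems by (simp add: e_def)
    also have "\<dots> = (\<Sum>r<length (D (Suc (Suc i))). \<phi> (Suc i) $$ (q, r) * w $ r)"
      using w(1) Suc.prems by (simp add: mult_mat_vec_index dim del: index_mult_mat_vec)
    also have "\<dots> \<in> irrelevant_ideal"
      using min Suc.prems by (intro poly_ideal_sum[OF irr] poly_idealD(4)[OF irr]) simp
    finally show False
      using irrelevant_ideal_constant_term[of "1 :: ('x, 'k) mpoly"] by simp
  qed
  then obtain p where p: "p < length (D i)" "\<phi> i $$ (p, q) \<noteq> 0" by blast
  \<comment> \<open>Any monomial of the nonzero entry has degree equal to the difference of the two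
    shifts, so the shift cannot decrease along this entry.\<close>
  obtain m where "poly_mapping.lookup (\<phi> i $$ (p, q)) m \<noteq> 0"
    using p(2) by (metis poly_mapping_eqI lookup_zero)
  moreover have "\<phi> i $$ (p, q) \<in> mdeg_eq (D (Suc i) ! q - D i ! p)"
    using gr[of i] p(1) Suc.prems by (simp add: graded_matrix_def)
  ultimately have "int (mon_degree m) = D (Suc i) ! q - D i ! p"
    by (auto simp: mspace_iff)
  then show ?case
    using Suc.IH[OF p(1)] by simp
qed

section \<open>Counting monomials by generating functions\<close>

definition monomials_in :: "'x::finite set \<Rightarrow> nat \<Rightarrow> ('x \<Rightarrow>\<^sub>0 nat) set" where
  "monomials_in A d = {m. Poly_Mapping.keys m \<subseteq> A \<and> mon_degree m = d}"

lemma finite_monomials_in: "finite (monomials_in A d)"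
  by (rule finite_subset[OF _ finite_mon_degree_le[of d]]) (auto simp: monomials_in_def)

lemma mon_degree_single: "mon_degree (Poly_Mapping.single x n) = n"
  by (simp add: mon_degree_def lookup_single when_def)

text \<open>Division by x identifies the monomials divisible by x with those of degree one less. For
  generating functions this says that the factor \<open>1 - fps_X\<close> removes the variable x.
  The case \<open>d = 0\<close> is separate because of the truncated \<open>d - 1\<close>.\<close>

lemma card_monomials_in_insert:
  assumes "x \<notin> A"
  shows "card (monomials_in (insert x A) d) =
    card (monomials_in A d) + (if d = 0 then 0 else card (monomials_in (insert x A) (d - 1)))"
proof -
  let ?S = "{m \<in> monomials_in (insert x A) d. poly_mapping.lookup m x \<noteq> 0}"
  let ?s = "Poly_Mapping.single x 1 :: 'a \<Rightarrow>\<^sub>0 nat"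
  have split: "monomials_in (insert x A) d = monomials_in A d \<union> ?S"
    using assms by (auto simp: monomials_in_def in_keys_iff)
  have "monomials_in A d \<inter> ?S = {}"
    using assms by (auto simp: monomials_in_def in_keys_iff subset_iff)
  then have card: "card (monomials_in (insert x A) d) = card (monomials_in A d) + card ?S"
    by (subst split, subst card_Un_disjoint) (auto intro: finite_monomials_in finite_subset[OF _ finite_monomials_in])
  show ?thesis
  proof (cases d)
    case 0
    have "m \<notin> ?S" for m
      using lookup_le_mon_degree[of m x] 0 by (auto simp: monomials_in_def)
    then have "?S = {}" by blast
    then show ?thesis
      using card unfolding \<open>?S = {}\<close> by (simp add: 0)
  next
    case (Suc d')
    have "bij_betw (\<lambda>m. m + ?s) (monomials_in (insert x A) d') ?S"
    proof (rule bij_betw_byWitness[where f' = "\<lambda>m. m - ?s"])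
      have minus: "m - ?s + ?s = m" if "m \<in> ?S" for m
        using that by (intro poly_mapping_eqI) (auto simp: lookup_add lookup_minus lookup_single when_def)
      then show "\<forall>m\<in>?S. m - ?s + ?s = m" by blast
      show "(\<lambda>m. m - ?s) ` ?S \<subseteq> monomials_in (insert x A) d'"
      proof (intro image_subsetI)
        fix m assume m: "m \<in> ?S"
        then have m': "Poly_Mapping.keys m \<subseteq> insert x A" "mon_degree m = d"
          by (simp_all add: monomials_in_def)
        have "mon_degree (m - ?s) + 1 = mon_degree m"
          using arg_cong[OF minus[OF m], of mon_degree] by (simp only: mon_degree_add mon_degree_single)
        moreover have "Poly_Mapping.keys (m - ?s) \<subseteq> Poly_Mapping.keys m"
          by (auto simp: in_keys_iff lookup_minus)
        ultimately show "m - ?s \<in> monomials_in (insert x A) d'"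
          using m' Suc by (simp add: monomials_in_def)
      qed
      show "(\<lambda>m. m + ?s) ` monomials_in (insert x A) d' \<subseteq> ?S"
      proof (intro image_subsetI)
        fix m assume m: "m \<in> monomials_in (insert x A) d'"
        have "Poly_Mapping.keys (m + ?s) \<subseteq> Poly_Mapping.keys m \<union> {x}"
          using keys_add[of m ?s] by simp
        then show "m + ?s \<in> ?S"
          using m Suc by (auto simp: monomials_in_def lookup_add mon_degree_add mon_degree_single)
      qed
    qed simp
    then have "card (monomials_in (insert x A) d') = card ?S"
      by (rule bij_betw_same_card)
    then show ?thesis
      using card Suc by simp
  qed
qed

lemma monomials_in_fps:
  "Abs_fps (\<lambda>d. of_nat (card (monomials_in A d))) * (1 - fps_X) ^ card A = (1 :: rat fps)"
proof -
  have "finite A" by simp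
  then show ?thesis
  proof (induction A rule: finite_induct)
    case empty
    have "monomials_in {} d = (if d = 0 then {0 :: 'a \<Rightarrow>\<^sub>0 nat} else {})" for d
      by (auto simp: monomials_in_def)
    then have "card (monomials_in {} d :: ('a \<Rightarrow>\<^sub>0 nat) set) = (if d = 0 then 1 else 0)" for d
      by simp
    then show ?case
      by (intro fps_ext) simp
  next
    case (insert x A)
    let ?F = "\<lambda>A. Abs_fps (\<lambda>d. of_nat (card (monomials_in A d))) :: rat fps"
    have "?F (insert x A) * (1 - fps_X) = ?F A"
      by (intro fps_ext) (simp add: algebra_simps card_monomials_in_insert[OF insert.hyps(2)])
    then show ?case
      using insert by (simp add: mult.assoc[symmetric])
  qed
qed

lemma num_monomials_fps:
  "Abs_fps (\<lambda>d. of_nat (num_monomials TYPE('x::finite) (int d))) * (1 - fps_X) ^ CARD('x) = (1 :: rat fps)"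
  using monomials_in_fps[of "UNIV :: 'x set"] by (simp add: num_monomials_def monomials_in_def)

text \<open>A shift by D delays the series by D places, which is multiplication by a power of
  \<open>fps_X\<close>; a negative shift would advance it and cut off coefficients.\<close>

lemma num_monomials_shift_fps:
  assumes "D \<ge> 0"
  shows "Abs_fps (\<lambda>d. of_nat (num_monomials TYPE('x::finite) (int d - D))) * (1 - fps_X) ^ CARD('x) = (fps_X ^ nat D :: rat fps)"
proof -
  have "num_monomials TYPE('x) (int d - D) = (if d < nat D then 0 else num_monomials TYPE('x) (int (d - nat D)))" for d
  proof (cases "d < nat D")
    case True
    then have "{m :: 'x \<Rightarrow>\<^sub>0 nat. int (mon_degree m) = int d - D} = {}" by auto
    then show ?thesis
      using True by (simp only: num_monomials_def) simp
  next
    case False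
    then have "int d - D = int (d - nat D)"
      using assms by linarith
    then show ?thesis
      using False by simp
  qed
  then have "Abs_fps (\<lambda>d. of_nat (num_monomials TYPE('x) (int d - D))) =
      (fps_X ^ nat D * Abs_fps (\<lambda>d. of_nat (num_monomials TYPE('x) (int d))) :: rat fps)"
    by (intro fps_ext) (simp add: fps_X_power_mult_nth)
  then show ?thesis
    using num_monomials_fps[where 'x = 'x] by (simp add: mult.assoc)
qed

lemma minimal_resolution_hilbert_series:
  fixes I :: "('x::finite, 'k::field) mpoly set"
  assumes I: "poly_ideal I" "1 \<notin> I"
    and res: "minimal_graded_free_resolution I D \<phi>" and len: "\<And>i. i > L \<Longrightarrow> D i = []"
  shows "hilbert_series I * (1 - fps_X) ^ CARD('x) =
    fps_of_poly (\<Sum>i\<le>L. (-1) ^ i * (\<Sum>q<length (D i). monom 1 (nat (D i ! q))))"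
proof -
  have gres: "graded_free_resolution I D \<phi>"
    using res by (simp add: minimal_graded_free_resolution_def)
  let ?N = "\<lambda>D. Abs_fps (\<lambda>d. of_nat (num_monomials TYPE('x) (int d - D))) :: rat fps"
  have coeff: "of_nat (hilbert_function I d) =
      (\<Sum>i\<le>L. (-1) ^ i * (\<Sum>q<length (D i). of_nat (num_monomials TYPE('x) (int d - D i ! q))) :: rat)" for d
    unfolding hilbert_function_eq_graded_hilbert[OF I]
    using arg_cong[OF graded_free_resolution_hilbert[OF gres len, of L d], of "of_int :: int \<Rightarrow> rat"] by simp
  have neg: "((-1) ^ i * F) $ d = (-1) ^ i * F $ d" for i d and F :: "rat fps"
    by (cases "even i") simp_all
  have "hilbert_series I = (\<Sum>i\<le>L. (-1) ^ i * (\<Sum>q<length (D i). ?N (D i ! q)))"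
    by (intro fps_ext) (simp add: hilbert_series_def coeff fps_sum_nth neg)
  then have "hilbert_series I * (1 - fps_X) ^ CARD('x) =
      (\<Sum>i\<le>L. (-1) ^ i * (\<Sum>q<length (D i). ?N (D i ! q) * (1 - fps_X) ^ CARD('x)))"
    by (simp only: sum_distrib_right mult.assoc)
  also have "\<dots> = (\<Sum>i\<le>L. (-1) ^ i * (\<Sum>q<length (D i). fps_X ^ nat (D i ! q)))"
    using minimal_resolution_shifts_nonneg[OF res]
    by (intro sum.cong refl arg_cong2[where f = "(*)"] num_monomials_shift_fps) simp
  also have "\<dots> = fps_of_poly (\<Sum>i\<le>L. (-1) ^ i * (\<Sum>q<length (D i). monom 1 (nat (D i ! q))))"
    by (simp add: fps_of_poly_sum fps_of_poly_mult fps_of_poly_power fps_of_poly_uminus fps_of_poly_monom)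
  finally show ?thesis .
qed

section \<open>The order of the pole at 1\<close>

lemma binomial_fps:
  "Abs_fps (\<lambda>d. of_nat ((d + m) choose m)) * (1 - fps_X) ^ Suc m = (1 :: 'a::comm_ring_1 fps)"
proof (induction m)
  case 0
  have "Abs_fps (\<lambda>d. 1) * (1 - fps_X) = (1 :: 'a fps)"
    by (intro fps_ext) (simp add: algebra_simps)
  then show ?case by simp
next
  case (Suc m)
  have "Abs_fps (\<lambda>d. of_nat ((d + Suc m) choose Suc m)) * (1 - fps_X) = (Abs_fps (\<lambda>d. of_nat ((d + m) choose m)) :: 'a fps)"
  proof (intro fps_ext)
    fix d
    show "(Abs_fps (\<lambda>d. of_nat ((d + Suc m) choose Suc m)) * (1 - fps_X)) $ d = (Abs_fps (\<lambda>d. of_nat ((d + m) choose m)) :: 'a fps) $ d"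
      by (cases d) (simp_all add: algebra_simps binomial_eq_0)
  qed
  then show ?case
    using Suc by (simp add: mult.assoc[symmetric])
qed

text \<open>The binomial coefficient is a product of m factors \<open>d - j + 1 + i\<close> divided
  by \<open>fact m\<close>, and each factor is asymptotic to \<open>d + 1\<close>.\<close>

lemma binomial_ratio_tendsto:
  "(\<lambda>d. real ((d - j + m) choose m) / real (Suc d) ^ m) \<longlonglongrightarrow> 1 / fact m"
proof -
  have "(\<lambda>d. 1 + (real i - real j) * inverse (real (Suc d))) \<longlonglongrightarrow> 1 + (real i - real j) * 0" for i
    by (intro tendsto_intros LIMSEQ_inverse_real_of_nat)
  then have "(\<lambda>d. (\<Prod>i<m. 1 + (real i - real j) * inverse (real (Suc d))) / fact m) \<longlonglongrightarrow> (\<Prod>i<m. 1) / fact m"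
    by (intro tendsto_intros) simp_all
  then have lim: "(\<lambda>d. (\<Prod>i<m. 1 + (real i - real j) * inverse (real (Suc d))) / fact m) \<longlonglongrightarrow> 1 / fact m"
    by simp
  have "\<forall>\<^sub>F d in sequentially. (\<Prod>i<m. 1 + (real i - real j) * inverse (real (Suc d))) / fact m =
      real ((d - j + m) choose m) / real (Suc d) ^ m"
    \<comment> \<open>From \<open>d = j\<close> on, the truncated \<open>d - j\<close> is a genuine
      difference.\<close>
    using eventually_ge_at_top[of j]
  proof eventually_elim
    case (elim d)
    have "real ((d - j + m) choose m) = pochhammer (real (d - j) + 1) m / fact m"
      by (simp add: binomial_gbinomial gbinomial_pochhammer')
    also have "\<dots> = (\<Prod>i<m. real (d - j) + 1 + real i) / fact m"
      by (simp add: pochhammer_prod atLeast0LessThan)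
    also have "\<dots> = (\<Prod>i<m. (1 + (real i - real j) * inverse (real (Suc d))) * real (Suc d)) / fact m"
      using elim by (intro arg_cong2[where f = "(/)"] prod.cong refl) (simp add: field_simps of_nat_diff)
    also have "\<dots> = (\<Prod>i<m. 1 + (real i - real j) * inverse (real (Suc d))) / fact m * real (Suc d) ^ m"
      by (simp add: prod.distrib)
    finally show ?case
      by (simp del: of_nat_Suc)
  qed
  then show ?thesis
    by (rule Lim_transform_eventually[OF lim])
qed

text \<open>If \<open>q 1\<close> were nonzero, the partial sums of H would grow like \<open>q 1 * d ^ m / m!\<close>.\<close>
lemma numerator_root_1:
  fixes H :: "nat \<Rightarrow> nat" and q :: "rat poly"
  assumes eq: "Abs_fps (\<lambda>d. of_nat (H d)) * (1 - fps_X) ^ m = fps_of_poly q"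
    and growth: "\<And>d. (\<Sum>i\<le>d. H i) \<le> C * (d + 1) ^ m'" and "m' < m"
  shows "poly q 1 = 0"
proof -
  \<comment> \<open>Partial summation multiplies the series by \<open>1 / (1 - t)\<close>, so the
    power of \<open>1 - t\<close> rises to \<open>Suc m\<close> and the coefficients of its inverse
    are binomials of order m.\<close>
  define G where "G d = (\<Sum>i\<le>d. H i)" for d
  let ?B = "Abs_fps (\<lambda>d. of_nat ((d + m) choose m)) :: rat fps"
  have "Abs_fps (\<lambda>d. of_nat (G d)) * (1 - fps_X) = (Abs_fps (\<lambda>d. of_nat (H d)) :: rat fps)"
  proof (intro fps_ext)
    fix d
    show "(Abs_fps (\<lambda>d. of_nat (G d)) * (1 - fps_X)) $ d = (Abs_fps (\<lambda>d. of_nat (H d)) :: rat fps) $ d"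
      by (cases d) (simp_all add: algebra_simps G_def)
  qed
  then have G: "Abs_fps (\<lambda>d. of_nat (G d)) * (1 - fps_X) ^ Suc m = fps_of_poly q"
    using eq by (simp add: mult.assoc[symmetric])
  have "fps_of_poly q * ?B = Abs_fps (\<lambda>d. of_nat (G d)) * (?B * (1 - fps_X) ^ Suc m)"
    unfolding G[symmetric] by (simp only: mult_ac)
  then have "Abs_fps (\<lambda>d. of_nat (G d)) = fps_of_poly q * ?B"
    by (simp only: binomial_fps mult_1_right)
  then have "of_nat (G d) = (fps_of_poly q * ?B) $ d" for d
    by (metis fps_nth_Abs_fps)
  then have coeff: "of_nat (G d) = (\<Sum>j=0..d. coeff q j * of_nat ((d - j + m) choose m))" for d
    by (simp add: fps_mult_nth)
  define e where "e = degree q"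
  define r where "r j = (of_rat (coeff q j) :: real)" for j
  \<comment> \<open>Once d reaches the degree of q, the number of summands no longer depends on d
    and limits can be taken term by term.\<close>
  have "real (G d) = (\<Sum>j\<le>e. r j * real ((d - j + m) choose m))" if "d \<ge> e" for d
  proof -
    have "of_nat (G d) = (\<Sum>j\<le>e. coeff q j * of_nat ((d - j + m) choose m))"
      unfolding coeff using that by (intro sum.mono_neutral_right) (auto simp: e_def coeff_eq_0)
    then have "(of_rat (of_nat (G d)) :: real) = of_rat (\<Sum>j\<le>e. coeff q j * of_nat ((d - j + m) choose m))"
      by (rule arg_cong)
    then show ?thesis
      by (simp add: of_rat_sum of_rat_mult r_def)
  qed
  then have "\<forall>\<^sub>F d in sequentially. (\<Sum>j\<le>e. r j * (real ((d - j + m) choose m) / real (Suc d) ^ m)) = real (G d) / real (Suc d) ^ m"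
    by (intro eventually_mono[OF eventually_ge_at_top[of e]]) (simp add: sum_divide_distrib)
  moreover have "(\<lambda>d. \<Sum>j\<le>e. r j * (real ((d - j + m) choose m) / real (Suc d) ^ m)) \<longlonglongrightarrow> (\<Sum>j\<le>e. r j * (1 / fact m))"
    by (intro tendsto_intros binomial_ratio_tendsto)
  ultimately have lim: "(\<lambda>d. real (G d) / real (Suc d) ^ m) \<longlonglongrightarrow> (\<Sum>j\<le>e. r j * (1 / fact m))"
    by (rule Lim_transform_eventually[rotated])
  have "(\<lambda>d. real (G d) / real (Suc d) ^ m) \<longlonglongrightarrow> 0"
  proof (rule real_tendsto_sandwich[where f = "\<lambda>_. 0" and h = "\<lambda>d. real C * inverse (real (Suc d))"])
    show "(\<lambda>d. real C * inverse (real (Suc d))) \<longlonglongrightarrow> 0"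
      using tendsto_mult_right_zero[OF LIMSEQ_inverse_real_of_nat] .
    have "real (G d) / real (Suc d) ^ m \<le> real C * inverse (real (Suc d))" for d
    proof -
      \<comment> \<open>Since \<open>m' < m\<close>, the growth bound leaves a factor
        \<open>Suc d\<close> to spare.\<close>
      have "G d * Suc d \<le> C * Suc d ^ m' * Suc d"
        using growth[of d] by (simp add: G_def del: mult_Suc mult_Suc_right)
      also have "\<dots> = C * Suc d ^ Suc m'"
        by (simp add: mult_ac)
      also have "\<dots> \<le> C * Suc d ^ m"
        using \<open>m' < m\<close> by (intro mult_left_mono power_increasing) auto
      finally have "real (G d) * real (Suc d) \<le> real C * real (Suc d) ^ m"
        by (simp only: of_nat_mult[symmetric] of_nat_power[symmetric] of_nat_le_iff)
      then show ?thesis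
        by (simp add: field_simps del: of_nat_Suc)
    qed
    then show "\<forall>\<^sub>F d in sequentially. real (G d) / real (Suc d) ^ m \<le> real C * inverse (real (Suc d))"
      by simp
  qed simp_all
  then have "(\<Sum>j\<le>e. r j * (1 / fact m)) = 0"
    using lim LIMSEQ_unique by blast
  then have "(\<Sum>j\<le>e. r j) = 0"
    unfolding sum_distrib_right[symmetric] by simp
  moreover have "(\<Sum>j\<le>e. r j) = of_rat (poly q 1)"
    by (simp add: r_def poly_altdef e_def of_rat_sum)
  ultimately show ?thesis
    by simp
qed

text \<open>While fewer than s factors are split off, the exponent \<open>n - v\<close> exceeds the
  growth order \<open>n - s\<close>, so the remaining numerator vanishes at 1 and yields one more
  factor. Power series over a field have no zero divisors, so \<open>1 - fps_X\<close>
  cancels.\<close>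

lemma numerator_factor:
  fixes H :: "nat \<Rightarrow> nat" and p :: "rat poly"
  assumes eq: "Abs_fps (\<lambda>d. of_nat (H d)) * (1 - fps_X) ^ n = fps_of_poly p"
    and growth: "\<And>d. (\<Sum>i\<le>d. H i) \<le> C * (d + 1) ^ (n - s)" and "s \<le> n"
  shows "\<exists>Q. p = [:1, -1:] ^ s * Q \<and> Abs_fps (\<lambda>d. of_nat (H d)) * (1 - fps_X) ^ (n - s) = fps_of_poly Q"
proof -
  have lin: "fps_of_poly [:1, -1:] = (1 - fps_X :: rat fps)"
    by (simp add: fps_of_poly_pCons)
  have "1 - fps_X \<noteq> (0 :: rat fps)"
    unfolding lin[symmetric] by (metis fps_of_poly_0 fps_of_poly_eq_iff one_pCons pCons_eq_0_iff zero_neq_one)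
  have "\<exists>Q. p = [:1, -1:] ^ v * Q \<and> Abs_fps (\<lambda>d. of_nat (H d)) * (1 - fps_X) ^ (n - v) = fps_of_poly Q" if "v \<le> s" for v
    using that
  proof (induction v)
    case 0
    then show ?case
      using eq by simp
  next
    case (Suc v)
    then obtain Q where Q: "p = [:1, -1:] ^ v * Q" "Abs_fps (\<lambda>d. of_nat (H d)) * (1 - fps_X) ^ (n - v) = fps_of_poly Q"
      by auto
    have "poly Q 1 = 0"
      using Suc.prems \<open>s \<le> n\<close> by (intro numerator_root_1[OF Q(2) growth]) simp
    then obtain Q' where Q': "Q = [:-1, 1:] * Q'"
      by (auto simp: poly_eq_0_iff_dvd)
    have Q'': "Q = [:1, -1:] * (- Q')"
      unfolding Q' by simp
    have "n - v = Suc (n - Suc v)"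
      using Suc.prems \<open>s \<le> n\<close> by simp
    then have "(1 - fps_X) * (Abs_fps (\<lambda>d. of_nat (H d)) * (1 - fps_X) ^ (n - Suc v)) = (1 - fps_X) * fps_of_poly (- Q')"
      using Q(2) unfolding Q'' fps_of_poly_mult lin by (simp only: power_Suc mult_ac)
    then have "Abs_fps (\<lambda>d. of_nat (H d)) * (1 - fps_X) ^ (n - Suc v) = fps_of_poly (- Q')"
      using \<open>1 - fps_X \<noteq> (0 :: rat fps)\<close> by (simp only: mult_cancel_left) simp
    moreover have "p = [:1, -1:] ^ Suc v * (- Q')"
      using Q(1) unfolding Q'' by (simp only: power_Suc mult_ac)
    ultimately show ?case by blast
  qed
  then show ?thesis by blast
qed

section \<open>Moments of the shifts\<close>

text \<open>Taylor expansion at 1: translation commutes with \<open>pderiv\<close>, so derivatives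
  at 1 become coefficients after substituting \<open>1 + x\<close>.\<close>

lemma poly_higher_pderiv_at_1:
  fixes p :: "'a::field_char_0 poly"
  shows "poly ((pderiv ^^ m) p) 1 = fact m * coeff (pcompose p [:1, 1:]) m"
proof -
  have comm: "(pderiv ^^ m) (pcompose p [:1, 1:]) = pcompose ((pderiv ^^ m) p) [:1, 1:]"
    by (induction m) (simp_all add: pderiv_pcompose pderiv_pCons)
  have "poly ((pderiv ^^ m) p) 1 = poly (pcompose ((pderiv ^^ m) p) [:1, 1:]) 0"
    by (simp add: poly_pcompose)
  also have "\<dots> = coeff ((pderiv ^^ m) (pcompose p [:1, 1:])) 0"
    by (simp add: comm poly_0_coeff_0)
  finally show ?thesis
    by (simp add: coeff_higher_pderiv pochhammer_fact)
qed

text \<open>Substituting \<open>1 + x\<close> for t turns \<open>1 - t\<close> into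
  \<open>- x\<close>, whence the index shift by s and the sign.\<close>

lemma coeff_pcompose_factor:
  fixes Q :: "'a::comm_ring_1 poly"
  shows "coeff (pcompose ([:1, -1:] ^ s * Q) [:1, 1:]) m =
    (if m < s then 0 else (-1) ^ s * coeff (pcompose Q [:1, 1:]) (m - s))"
proof -
  have pow: "pcompose (p ^ s) q = pcompose p q ^ s" for p q :: "'a poly" and s
    by (induction s) (simp_all add: pcompose_mult pcompose_1)
  have "pcompose [:1, -1:] [:1, 1:] = (monom (-1) 1 :: 'a poly)"
    by (simp add: pcompose_pCons monom_Suc monom_0)
  then have "pcompose ([:1, -1:] ^ s * Q) [:1, 1:] = monom ((-1) ^ s) s * pcompose Q [:1, 1:]"
    by (simp add: pcompose_mult pow monom_power)
  then show ?thesis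
    by (simp add: coeff_monom_mult)
qed

section \<open>Falling factorials and power sums\<close>

definition falling :: "nat \<Rightarrow> rat \<Rightarrow> rat" where
  "falling m x = (\<Prod>i<m. x - of_nat i)"

lemma coeff_pcompose_monom:
  "fact m * coeff (pcompose (monom 1 n) [:1, 1:]) m = falling m (of_nat n)"
proof -
  have "pcompose (monom 1 n) [:1, 1:] = [:1, 1::rat:] ^ n"
  proof (induction n)
    case (Suc n)
    then show ?case
      by (simp add: monom_Suc pcompose_pCons)
  qed (simp add: monom_0)
  moreover have "coeff ([:1, 1::rat:] ^ n) m = of_nat (n choose m)"
  proof (cases "m \<le> n")
    case False
    then have "degree ([:1, 1::rat:] ^ n) < m"
      by (simp add: degree_power_eq)
    then show ?thesis
      using False by (simp add: coeff_eq_0 binomial_eq_0)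
  qed (simp add: coeff_linear_poly_power)
  ultimately show ?thesis
    by (simp add: binomial_gbinomial gbinomial_prod_rev falling_def atLeast0LessThan)
qed

text \<open>Powers are combinations of falling factorials of no larger order. The mixed products
  \<open>x ^ a * falling b x\<close> let one factor x at a time be absorbed by
  \<open>x * falling b x = falling (Suc b) x + b * falling b x\<close>, so no explicit coefficients
  occur.\<close>

lemma moments_vanish:
  fixes L :: "(rat \<Rightarrow> rat) \<Rightarrow> rat"
  assumes add: "\<And>f g. L (\<lambda>x. f x + g x) = L f + L g" and scale: "\<And>c f. L (\<lambda>x. c * f x) = c * L f"
    and falling: "\<And>m. m < s \<Longrightarrow> L (falling m) = 0"
    and "m < s"
  shows "L (\<lambda>x. x ^ m) = 0"
proof -
  have "L (\<lambda>x. x ^ a * falling b x) = 0" if "a + b < s" for a b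
    using that
  proof (induction a arbitrary: b)
    case 0
    then show ?case
      using falling[of b] by simp
  next
    case (Suc a)
    have "x ^ Suc a * falling b x = x ^ a * falling (Suc b) x + of_nat b * (x ^ a * falling b x)" for x
      by (simp add: falling_def algebra_simps)
    then show ?case
      using Suc.IH[of "Suc b"] Suc.IH[of b] Suc.prems by (simp add: add scale)
  qed
  from this[of m 0] show ?thesis
    using \<open>m < s\<close> by (simp add: falling_def)
qed

text \<open>The root 0 contributes the factor x, and the product over the roots
  \<open>1, ..., s + l - 1\<close> is expanded over subsets of roots, grouped by size. The condition
  on s ensures that the root 0 is present and that \<open>s + l - 1\<close> is not
  truncated.\<close>

lemma falling_expansion:
  assumes "s \<ge> 1"
  shows "falling (s + l) x = (\<Sum>q\<le>s + l - 1. (-1) ^ q * of_nat (nu s l q) * x ^ (s + l - q))"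
proof -
  let ?A = "{1..s + l - 1}"
  have "falling (s + l) x = (\<Prod>i<Suc (s + l - 1). x - of_nat i)"
    using assms by (simp add: falling_def)
  also have "\<dots> = x * (\<Prod>i<s + l - 1. x - of_nat (Suc i))"
    by (subst prod.lessThan_Suc_shift) simp
  also have "(\<Prod>i<s + l - 1. x - of_nat (Suc i)) = (\<Prod>\<xi>\<in>?A. x - of_nat \<xi>)"
    by (rule prod.reindex_bij_witness[of _ "\<lambda>i. i - 1" Suc]) auto
  also have "\<dots> = (\<Sum>B\<in>Pow ?A. (-1) ^ card B * (\<Prod>\<xi>\<in>B. of_nat \<xi>) * (\<Prod>\<xi>\<in>?A - B. x))"
    by (rule prod_diff_conv_sum) simp
  also have "\<dots> = (\<Sum>q\<le>s + l - 1. \<Sum>B\<in>{B \<in> Pow ?A. card B = q}. (-1) ^ card B * (\<Prod>\<xi>\<in>B. of_nat \<xi>) * (\<Prod>\<xi>\<in>?A - B. x))"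
  proof (rule sum.group[symmetric])
    show "card ` Pow ?A \<subseteq> {..s + l - 1}"
      using card_mono[of ?A] by fastforce
  qed simp_all
  also have "\<dots> = (\<Sum>q\<le>s + l - 1. (-1) ^ q * of_nat (nu s l q) * x ^ (s + l - 1 - q))"
  proof (intro sum.cong refl)
    fix q
    have "(\<Prod>\<xi>\<in>?A - B. x) = x ^ (s + l - 1 - card B)" if "B \<subseteq> ?A" for B
      using that finite_subset[OF that] by (simp add: card_Diff_subset)
    then have "(\<Sum>B\<in>{B \<in> Pow ?A. card B = q}. (-1) ^ card B * (\<Prod>\<xi>\<in>B. of_nat \<xi>) * (\<Prod>\<xi>\<in>?A - B. x)) =
        (\<Sum>B\<in>{B \<in> Pow ?A. card B = q}. (-1) ^ q * (\<Prod>\<xi>\<in>B. of_nat \<xi>) * x ^ (s + l - 1 - q))"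
      by (intro sum.cong) auto
    also have "\<dots> = (-1) ^ q * of_nat (nu s l q) * x ^ (s + l - 1 - q)"
      by (simp add: nu_def sum_distrib_left sum_distrib_right)
    finally show "(\<Sum>B\<in>{B \<in> Pow ?A. card B = q}. (-1) ^ card B * (\<Prod>\<xi>\<in>B. of_nat \<xi>) * (\<Prod>\<xi>\<in>?A - B. x)) =
        (-1) ^ q * of_nat (nu s l q) * x ^ (s + l - 1 - q)" .
  qed
  also have "x * \<dots> = (\<Sum>q\<le>s + l - 1. (-1) ^ q * of_nat (nu s l q) * x ^ (s + l - q))"
    unfolding sum_distrib_left
  proof (intro sum.cong refl)
    fix q assume "q \<in> {..s + l - 1}"
    then have "s + l - q = Suc (s + l - 1 - q)"
      using assms by auto
    then show "x * ((-1) ^ q * of_nat (nu s l q) * x ^ (s + l - 1 - q)) = (-1) ^ q * of_nat (nu s l q) * x ^ (s + l - q)"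
      by simp
  qed
  finally show ?thesis .
qed

text \<open>The complete homogeneous polynomial of degree N in two variables with sum c and product u.\<close>
definition hom_complete :: "nat \<Rightarrow> rat \<Rightarrow> rat \<Rightarrow> rat" where
  "hom_complete N c u = (\<Sum>t\<le>N. (-1) ^ t * of_nat ((N - t) choose t) * c ^ (N - 2 * t) * u ^ t)"

text \<open>The recurrence of the complete homogeneous polynomials in the elementary symmetric ones;
  on coefficients it is Pascal's rule.\<close>

lemma hom_complete_rec: "hom_complete (Suc (Suc N)) c u = c * hom_complete (Suc N) c u - u * hom_complete N c u"
proof -
  have *: "(-1) ^ Suc t * of_nat ((Suc (Suc N) - Suc t) choose Suc t) * c ^ (Suc (Suc N) - 2 * Suc t) * u ^ Suc t =
      c * ((-1) ^ Suc t * of_nat ((Suc N - Suc t) choose Suc t) * c ^ (Suc N - 2 * Suc t) * u ^ Suc t) -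
      u * ((-1) ^ t * of_nat ((N - t) choose t) * c ^ (N - 2 * t) * u ^ t)" if "t \<le> N" for t
  proof -
    \<comment> \<open>If \<open>2 * t \<ge> N\<close>, the exponents are truncated, but then the
      binomial coefficient is 0.\<close>
    have *: "c * (of_nat ((N - t) choose Suc t) * c ^ (Suc N - 2 * Suc t)) = of_nat ((N - t) choose Suc t) * c ^ (N - 2 * t)"
    proof (cases "2 * t < N")
      case True
      then have "N - 2 * t = Suc (Suc N - 2 * Suc t)" by simp
      then show ?thesis by simp
    qed (simp add: binomial_eq_0)
    have "c * ((-1) ^ Suc t * of_nat ((Suc N - Suc t) choose Suc t) * c ^ (Suc N - 2 * Suc t) * u ^ Suc t) =
        (-1) ^ Suc t * (c * (of_nat ((N - t) choose Suc t) * c ^ (Suc N - 2 * Suc t))) * u ^ Suc t"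
      by (simp only: diff_Suc_Suc mult_ac)
    also have "\<dots> = (-1) ^ Suc t * (of_nat ((N - t) choose Suc t) * c ^ (N - 2 * t)) * u ^ Suc t"
      by (simp only: *)
    moreover have "(Suc (Suc N) - Suc t) choose Suc t = ((N - t) choose t) + ((N - t) choose Suc t)"
      using that by (simp add: Suc_diff_le)
    moreover have "Suc (Suc N) - 2 * Suc t = N - 2 * t"
      by simp
    ultimately show ?thesis
      by (simp only: of_nat_add) (simp add: algebra_simps)
  qed
  have "hom_complete (Suc (Suc N)) c u = c ^ Suc (Suc N) + (\<Sum>t\<le>Suc N. (-1) ^ Suc t *
      of_nat ((Suc (Suc N) - Suc t) choose Suc t) * c ^ (Suc (Suc N) - 2 * Suc t) * u ^ Suc t)"
    unfolding hom_complete_def by (subst sum.atMost_Suc_shift) simp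
  also have "\<dots> = c ^ Suc (Suc N) + (\<Sum>t\<le>N. (-1) ^ Suc t *
      of_nat ((Suc (Suc N) - Suc t) choose Suc t) * c ^ (Suc (Suc N) - 2 * Suc t) * u ^ Suc t)"
    by (subst sum.atMost_Suc) simp
  also have "(\<Sum>t\<le>N. (-1) ^ Suc t *
      of_nat ((Suc (Suc N) - Suc t) choose Suc t) * c ^ (Suc (Suc N) - 2 * Suc t) * u ^ Suc t) =
      (\<Sum>t\<le>N. c * ((-1) ^ Suc t * of_nat ((Suc N - Suc t) choose Suc t) * c ^ (Suc N - 2 * Suc t) * u ^ Suc t)) -
      u * hom_complete N c u"
    unfolding hom_complete_def sum_distrib_left sum_subtractf[symmetric] by (intro sum.cong refl *) simp
  also have "c ^ Suc (Suc N) + (\<dots>) = c * hom_complete (Suc N) c u - u * hom_complete N c u"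
    unfolding hom_complete_def[of "Suc N"] sum.atMost_Suc_shift sum_distrib_left distrib_left by simp
  finally show ?thesis .
qed

text \<open>Both x and \<open>c - x\<close> are roots of the characteristic polynomial of the
  recurrence with parameters c and \<open>x * (c - x)\<close>, so the two sides satisfy the same
  recurrence. The factor \<open>c - 2 * x\<close> is the difference of the roots.\<close>

lemma power_diff_hom_complete:
  fixes x c :: rat
  shows "x ^ Suc m - (c - x) ^ Suc m = - ((c - 2 * x) * hom_complete m c (x * (c - x)))"
proof (induction m rule: less_induct)
  case (less m)
  consider "m = 0" | "m = 1" | N where "m = Suc (Suc N)"
    by (metis One_nat_def not0_implies_Suc)
  then show ?case
  proof cases
    case 1
    then show ?thesis by (simp add: hom_complete_def)
  next
    case 2
    then show ?thesis by (simp add: hom_complete_def algebra_simps)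
  next
    case 3
    have "x ^ Suc m - (c - x) ^ Suc m = c * (x ^ Suc (Suc N) - (c - x) ^ Suc (Suc N)) - (x * (c - x)) * (x ^ Suc N - (c - x) ^ Suc N)"
      unfolding 3 by (simp add: algebra_simps)
    also have "\<dots> = c * (- ((c - 2 * x) * hom_complete (Suc N) c (x * (c - x)))) -
        (x * (c - x)) * (- ((c - 2 * x) * hom_complete N c (x * (c - x))))"
      using less[of "Suc N"] less[of N] 3 by simp
    also have "\<dots> = - ((c - 2 * x) * hom_complete m c (x * (c - x)))"
      by (simp only: 3 hom_complete_rec right_diff_distrib mult_minus_right mult_ac minus_diff_eq)
    finally show ?thesis .
  qed
qed

text \<open>The odd moments of order below \<open>2 * k + 1\<close> are triangular in the W t, which therefore vanish
  for \<open>t < k\<close>.\<close>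
lemma symmetric_moments:
  fixes V :: "(rat \<Rightarrow> rat) \<Rightarrow> rat" and c :: rat
  assumes add: "\<And>f g. V (\<lambda>x. f x + g x) = V f + V g" and scale: "\<And>c f. V (\<lambda>x. c * f x) = c * V f"
    and vanish: "\<And>m. m < 2 * k + 1 \<Longrightarrow> V (\<lambda>x. x ^ m - (c - x) ^ m) = 0"
  shows "V (\<lambda>x. x ^ (2 * k + 1 + r) - (c - x) ^ (2 * k + 1 + r)) =
    - ((-1) ^ k) * (\<Sum>t=0..r div 2. (-1) ^ t * of_nat ((k + r - t) choose (k + t)) * c ^ (r - 2 * t) *
      V (\<lambda>x. (x * (c - x)) ^ (k + t) * (c - 2 * x)))"
proof -
  define W where "W t = V (\<lambda>x. (x * (c - x)) ^ t * (c - 2 * x))" for t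
  have V0: "V (\<lambda>x. 0) = 0"
    using scale[of 0 "\<lambda>x. 0"] by simp
  have sum: "V (\<lambda>x. \<Sum>t\<in>A. f t x) = (\<Sum>t\<in>A. V (f t))" if "finite A" for f :: "nat \<Rightarrow> rat \<Rightarrow> rat" and A
    using that by (induction A rule: finite_induct) (simp_all add: V0 add)
  have M: "V (\<lambda>x. x ^ Suc m - (c - x) ^ Suc m) = - (\<Sum>t\<le>m. (-1) ^ t * of_nat ((m - t) choose t) * c ^ (m - 2 * t) * W t)" for m
  proof -
    have "(\<lambda>x. x ^ Suc m - (c - x) ^ Suc m) = (\<lambda>x. (-1) * (\<Sum>t\<le>m. ((-1) ^ t * of_nat ((m - t) choose t) * c ^ (m - 2 * t)) *
        ((x * (c - x)) ^ t * (c - 2 * x))))"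
      unfolding power_diff_hom_complete hom_complete_def
      by (simp add: fun_eq_iff sum_distrib_left sum_negf mult_ac)
    then have "V (\<lambda>x. x ^ Suc m - (c - x) ^ Suc m) = (-1) * (\<Sum>t\<le>m. ((-1) ^ t * of_nat ((m - t) choose t) * c ^ (m - 2 * t)) * W t)"
      by (simp only: scale sum finite_atMost W_def)
    then show ?thesis by simp
  qed
  have W0: "W t = 0" if "t < k" for t
    using that
  proof (induction t rule: less_induct)
    case (less t)
    have "0 = (\<Sum>t'\<le>2 * t. (-1) ^ t' * of_nat ((2 * t - t') choose t') * c ^ (2 * t - 2 * t') * W t')"
      using M[of "2 * t"] vanish[of "Suc (2 * t)"] less.prems by simp
    \<comment> \<open>Below t the induction hypothesis applies and above t the binomial is 0; what
      remains is \<open>W t\<close> with coefficient 1 or -1.\<close>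
    also have "\<dots> = (\<Sum>t'\<in>{t}. (-1) ^ t' * of_nat ((2 * t - t') choose t') * c ^ (2 * t - 2 * t') * W t')"
    proof (rule sum.mono_neutral_right)
      show "\<forall>t'\<in>{..2 * t} - {t}. (-1) ^ t' * of_nat ((2 * t - t') choose t') * c ^ (2 * t - 2 * t') * W t' = 0"
      proof
        fix t' assume "t' \<in> {..2 * t} - {t}"
        then consider "t' < t" | "2 * t - t' < t'" by fastforce
        then show "(-1) ^ t' * of_nat ((2 * t - t') choose t') * c ^ (2 * t - 2 * t') * W t' = 0"
          using less by cases (simp_all add: binomial_eq_0)
      qed
    qed auto
    finally show ?case by simp
  qed
  \<comment> \<open>The lower end of the range comes from the vanishing \<open>W t\<close>, the
    upper end from the vanishing binomials.\<close>
  have "(\<Sum>t\<le>2 * k + r. (-1) ^ t * of_nat ((2 * k + r - t) choose t) * c ^ (2 * k + r - 2 * t) * W t) =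
      (\<Sum>t\<in>{k..k + r div 2}. (-1) ^ t * of_nat ((2 * k + r - t) choose t) * c ^ (2 * k + r - 2 * t) * W t)"
  proof (rule sum.mono_neutral_right)
    show "\<forall>t\<in>{..2 * k + r} - {k..k + r div 2}. (-1) ^ t * of_nat ((2 * k + r - t) choose t) * c ^ (2 * k + r - 2 * t) * W t = 0"
    proof
      fix t assume "t \<in> {..2 * k + r} - {k..k + r div 2}"
      then consider "t < k" | "2 * k + r - t < t" by fastforce
      then show "(-1) ^ t * of_nat ((2 * k + r - t) choose t) * c ^ (2 * k + r - 2 * t) * W t = 0"
        using W0 by cases (simp_all add: binomial_eq_0)
    qed
  qed auto
  also have "\<dots> = (\<Sum>t=0..r div 2. (-1) ^ (k + t) * of_nat ((k + r - t) choose (k + t)) * c ^ (r - 2 * t) * W (k + t))"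
  proof -
    have "2 * k + r - (t + k) = k + r - t" "2 * k + r - 2 * (t + k) = r - 2 * t" for t
      by simp_all
    then show ?thesis
      using sum.shift_bounds_cl_nat_ivl[of "\<lambda>t. (-1) ^ t * of_nat ((2 * k + r - t) choose t) * c ^ (2 * k + r - 2 * t) * W t" 0 k "r div 2"]
      by (simp only: add_0_right add.commute[of _ k])
  qed
  also have "\<dots> = (-1) ^ k * (\<Sum>t=0..r div 2. (-1) ^ t * of_nat ((k + r - t) choose (k + t)) * c ^ (r - 2 * t) * W (k + t))"
    by (simp add: sum_distrib_left power_add mult.assoc)
  finally show ?thesis
    using M[of "2 * k + r"] by (simp add: W_def)
qed

text \<open>The dual positions i and \<open>2 * k + 1 - i\<close> have opposite parity, so the
  shifts a and \<open>c - a\<close> enter with opposite signs.\<close>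

lemma sum_gorenstein_shifts:
  fixes f :: "int \<Rightarrow> 'a::comm_ring_1"
  shows "(\<Sum>i\<le>2 * k + 1. (-1) ^ i * (\<Sum>q<length (gorenstein_shifts k b a c i). f (gorenstein_shifts k b a c i ! q))) =
    f 0 - f c + (\<Sum>i=1..k. \<Sum>j=1..b i. (-1) ^ i * (f (a i j) - f (c - a i j)))"
proof -
  let ?T = "\<lambda>i. (-1) ^ i * (\<Sum>q<length (gorenstein_shifts k b a c i). f (gorenstein_shifts k b a c i ! q))"
  have list: "(\<Sum>q<length xs. f (xs ! q)) = sum_list (map f xs)" for xs
    by (simp add: sum_list_sum_nth atLeast0LessThan)
  have map: "sum_list (map g [Suc 0..<Suc n]) = (\<Sum>j=Suc 0..n. g j)" for g :: "nat \<Rightarrow> 'a" and n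
    by (simp add: interv_sum_list_conv_sum_set_nat atLeastLessThanSuc_atLeastAtMost del: upt_Suc)
  have left: "?T i = (\<Sum>j=1..b i. (-1) ^ i * f (a i j))" if "i \<in> {1..k}" for i
    using that unfolding list by (simp add: gorenstein_shifts_def comp_def map sum_distrib_left del: upt_Suc)
  have right: "?T (2 * k + 1 - i) = - (\<Sum>j=1..b i. (-1) ^ i * f (c - a i j))" if "i \<in> {1..k}" for i
  proof -
    have "(-1) ^ (2 * k + 1 - i) = (- ((-1) ^ i) :: 'a)"
      using that by (cases "even i") auto
    moreover have "gorenstein_shifts k b a c (2 * k + 1 - i) = map (\<lambda>j. c - a i j) [1..<Suc (b i)]"
      using that by (auto simp: gorenstein_shifts_def)
    ultimately show ?thesis
      unfolding list by (simp add: comp_def map sum_distrib_left sum_negf del: upt_Suc)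
  qed
  have "{..2 * k + 1} = insert 0 (insert (2 * k + 1) ({1..k} \<union> {k + 1..2 * k}))"
    by auto
  then have "(\<Sum>i\<le>2 * k + 1. ?T i) = ?T 0 + (?T (2 * k + 1) + (sum ?T {1..k} + sum ?T {k + 1..2 * k}))"
    by (simp only:) (subst sum.insert, simp, simp, subst sum.insert, simp, simp, subst sum.union_disjoint, auto)
  also have "sum ?T {k + 1..2 * k} = (\<Sum>i=1..k. ?T (2 * k + 1 - i))"
    by (rule sum.reindex_bij_witness[of _ "\<lambda>i. 2 * k + 1 - i" "\<lambda>i. 2 * k + 1 - i"]) auto
  also have "sum ?T {1..k} + \<dots> = (\<Sum>i=1..k. \<Sum>j=1..b i. (-1) ^ i * (f (a i j) - f (c - a i j)))"
    unfolding sum.distrib[symmetric]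
    by (intro sum.cong refl) (simp only: left right, simp add: sum_subtractf right_diff_distrib)
  also have "?T 0 = f 0"
    by (simp add: gorenstein_shifts_def)
  also have "?T (2 * k + 1) = - f c"
    by (simp add: gorenstein_shifts_def)
  finally show ?thesis
    by simp
qed

theorem theorem3p5:
  fixes I :: "('x::finite, 'k::field) mpoly set"
    and k s l :: nat
    and b :: "nat \<Rightarrow> nat"
    and a :: "nat \<Rightarrow> nat \<Rightarrow> int"
    and c :: int
    and \<phi> :: "nat \<Rightarrow> ('x, 'k) mpoly mat"
  assumes "k \<ge> 1"
    and "homogeneous_ideal I"
    and "I \<subseteq> irrelevant_ideal"
    and "gorenstein_ring (PR Quot I)"
    and "s = 2 * k + 1"
    and "grade PR I = enat s"
    and "minimal_graded_free_resolution I (gorenstein_shifts k b a c) \<phi>"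
  shows "(-1) ^ k * fact (s + l) * hilbert_coefficient I (CARD('x) - s) l =
    (\<Sum>r=0..l. (-1) ^ (l - r) * of_nat (nu s l (l - r)) *
      (\<Sum>t=0..r div 2. (-1) ^ t * of_nat ((k + r - t) choose (k + t)) * of_int c ^ (r - 2 * t) *
        (\<Sum>i=1..k. \<Sum>j=1..b i. (-1) ^ i * of_int (a i j) ^ (k + t) *
           of_int (c - a i j) ^ (k + t) * of_int (c - 2 * a i j))))"
proof -
  let ?D = "gorenstein_shifts k b a c"
  define n where "n = CARD('x)"
  have I: "poly_ideal I" and I1: "1 \<notin> I"
    using assms(2,3) irrelevant_ideal_constant_term[of "1 :: ('x, 'k) mpoly"]
    by (auto intro: homogeneous_ideal_imp_poly_ideal)
  obtain C where C: "\<And>d. affine_hilbert I d \<le> C * (d + 1) ^ (n - s)" and "s \<le> n"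
    using grade_growth[OF I assms(6)] assms(5) by (auto simp: n_def)
  have growth: "(\<Sum>i\<le>d. hilbert_function I i) \<le> C * (d + 1) ^ (n - s)" for d
    using sum_graded_hilbert_le[OF assms(2), of d] C[of d]
    unfolding hilbert_function_eq_graded_hilbert[OF I I1] by linarith
  define P :: "rat poly" where "P = (\<Sum>i\<le>2 * k + 1. (-1) ^ i * (\<Sum>q<length (?D i). monom 1 (nat (?D i ! q))))"
  have "Abs_fps (\<lambda>d. of_nat (hilbert_function I d)) * (1 - fps_X) ^ n = fps_of_poly P"
    unfolding P_def n_def hilbert_series_def[symmetric]
    by (rule minimal_resolution_hilbert_series[OF I I1 assms(7)]) (simp add: gorenstein_shifts_def)
  then obtain Q where Q: "P = [:1, -1:] ^ s * Q" "hilbert_series I * (1 - fps_X) ^ (n - s) = fps_of_poly Q"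
    using numerator_factor[OF _ growth \<open>s \<le> n\<close>] by (auto simp: hilbert_series_def)
  \<comment> \<open>Since \<open>fps_of_poly\<close> is injective, the definite description can only
    be Q.\<close>
  have "hilbert_numerator I (n - s) = Q"
    unfolding hilbert_numerator_def Q(2) by (auto simp: fps_of_poly_eq_iff)
  then have coefficient: "hilbert_coefficient I (n - s) l = coeff (pcompose Q [:1, 1:]) l"
    by (simp add: hilbert_coefficient_def poly_higher_pderiv_at_1)

  \<comment> \<open>The moments are treated as a linear functional on functions, so that falling
    factorials and powers are handled by the same linearity rules.\<close>
  define L :: "(rat \<Rightarrow> rat) \<Rightarrow> rat" where
    "L f = (\<Sum>i\<le>2 * k + 1. (-1) ^ i * (\<Sum>q<length (?D i). f (of_int (?D i ! q))))" for f
  have L_add: "L (\<lambda>x. f x + g x) = L f + L g" for f g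
    unfolding L_def by (simp only: sum.distrib distrib_left)
  have L_scale: "L (\<lambda>x. w * f x) = w * L f" for w f
    unfolding L_def sum_distrib_left by (simp only: mult_ac)
  have L_sum: "L (\<lambda>x. \<Sum>q\<in>A. f q x) = (\<Sum>q\<in>A. L (f q))" for f :: "nat \<Rightarrow> rat \<Rightarrow> rat" and A
    unfolding L_def sum_distrib_left by (subst sum.swap) (simp only: sum.swap[of _ A])
  have coeff_neg: "coeff ((-1) ^ i * F) m = (-1) ^ i * coeff F m" for i m and F :: "rat poly"
    by (cases "even i") simp_all
  have falling: "fact m * coeff (pcompose P [:1, 1:]) m = L (falling m)" for m
  proof -
    have pneg: "pcompose ((-1) ^ i * F) [:1, 1:] = (-1) ^ i * pcompose F [:1, 1:]" for i and F :: "rat poly"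
      by (cases "even i") (simp_all add: pcompose_uminus)
    have "fact m * coeff (pcompose P [:1, 1:]) m =
        (\<Sum>i\<le>2 * k + 1. (-1) ^ i * (\<Sum>q<length (?D i). fact m * coeff (pcompose (monom 1 (nat (?D i ! q))) [:1, 1:]) m))"
      unfolding P_def pcompose_sum pneg coeff_sum coeff_neg sum_distrib_left by (simp only: mult_ac)
    also have "\<dots> = L (falling m)"
      unfolding L_def coeff_pcompose_monom using minimal_resolution_shifts_nonneg[OF assms(7)]
      by (intro sum.cong refl arg_cong2[where f = "(*)"]) simp
    finally show ?thesis .
  qed
  have vanish: "L (falling m) = 0" if "m < s" for m
    using that falling[of m] unfolding Q(1) coeff_pcompose_factor by simp
  have moment0: "L (\<lambda>x. x ^ m) = 0" if "m < s" for m
    by (rule moments_vanish[OF L_add L_scale vanish that])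
  have "odd s"
    using assms(5) by simp
  have "fact (s + l) * hilbert_coefficient I (n - s) l = - L (falling (s + l))"
    using falling[of "s + l"] \<open>odd s\<close> unfolding Q(1) coeff_pcompose_factor coefficient by simp
  also have "L (falling (s + l)) = (\<Sum>q\<le>s + l - 1. (-1) ^ q * of_nat (nu s l q) * L (\<lambda>x. x ^ (s + l - q)))"
  proof -
    have "falling (s + l) = (\<lambda>x. \<Sum>q\<le>s + l - 1. (-1) ^ q * of_nat (nu s l q) * x ^ (s + l - q))"
      using assms(5) by (intro ext falling_expansion) simp
    then show ?thesis
      by (simp only: L_sum L_scale)
  qed
  \<comment> \<open>For \<open>q > l\<close> the power sum has order below s and vanishes.\<close>
  also have "\<dots> = (\<Sum>q\<le>l. (-1) ^ q * of_nat (nu s l q) * L (\<lambda>x. x ^ (s + l - q)))"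
    using assms(5) by (intro sum.mono_neutral_right) (auto intro!: moment0)
  also have "\<dots> = (\<Sum>r=0..l. (-1) ^ (l - r) * of_nat (nu s l (l - r)) * L (\<lambda>x. x ^ (s + r)))"
    by (rule sum.reindex_bij_witness[of _ "\<lambda>r. l - r" "\<lambda>q. l - q"]) auto
  finally have main: "fact (s + l) * hilbert_coefficient I (n - s) l =
      - (\<Sum>r=0..l. (-1) ^ (l - r) * of_nat (nu s l (l - r)) * L (\<lambda>x. x ^ (s + r)))" .

  define c' :: rat where "c' = of_int c"
  \<comment> \<open>V takes one shift of each dual pair. Applied to a difference
    \<open>g x - g (c' - x)\<close>, the term at 0 accounts for the pair of end shifts 0 and
    c.\<close>
  define V :: "(rat \<Rightarrow> rat) \<Rightarrow> rat" where
    "V f = f 0 + (\<Sum>i=1..k. \<Sum>j=1..b i. (-1) ^ i * f (of_int (a i j)))" for f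
  have V_add: "V (\<lambda>x. f x + g x) = V f + V g" for f g
    by (simp add: V_def sum.distrib distrib_left)
  have V_scale: "V (\<lambda>x. w * f x) = w * V f" for w f
    by (simp add: V_def sum_distrib_left distrib_left mult_ac)
  have LV: "L (\<lambda>x. x ^ m) = V (\<lambda>x. x ^ m - (c' - x) ^ m)" for m
    using sum_gorenstein_shifts[where f = "\<lambda>x. of_int x ^ m :: rat" and k = k and b = b and a = a and c = c] by (simp add: L_def V_def c'_def)
  have moments: "L (\<lambda>x. x ^ (s + r)) = - ((-1) ^ k) *
      (\<Sum>t=0..r div 2. (-1) ^ t * of_nat ((k + r - t) choose (k + t)) * of_int c ^ (r - 2 * t) *
        (\<Sum>i=1..k. \<Sum>j=1..b i. (-1) ^ i * of_int (a i j) ^ (k + t) *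
           of_int (c - a i j) ^ (k + t) * of_int (c - 2 * a i j)))" for r
  proof -
    \<comment> \<open>As \<open>k \<ge> 1\<close>, the power of x is positive and the term at 0
      drops out.\<close>
    have "V (\<lambda>x. (x * (c' - x)) ^ (k + t) * (c' - 2 * x)) =
        (\<Sum>i=1..k. \<Sum>j=1..b i. (-1) ^ i * of_int (a i j) ^ (k + t) *
           of_int (c - a i j) ^ (k + t) * of_int (c - 2 * a i j))" for t
      using assms(1) by (simp add: V_def c'_def power_mult_distrib mult.assoc)
    moreover have "V (\<lambda>x. x ^ m - (c' - x) ^ m) = 0" if "m < 2 * k + 1" for m
      using moment0[of m] that assms(5) LV by simp
    ultimately show ?thesis
      unfolding LV assms(5) using symmetric_moments[where V = V and k = k and c = c' and r = r, OF V_add V_scale] by (simp only: c'_def)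
  qed
  have sign: "(-1) ^ k * (-1) ^ k = (1 :: rat)"
    by (simp add: power_mult_distrib[symmetric])
  \<comment> \<open>The minus sign that odd s leaves in \<open>main\<close>, together with the
    factor \<open>(-1) ^ k\<close> of the claim, cancels the sign in \<open>moments\<close>.\<close>
  have moment: "- ((-1) ^ k) * L (\<lambda>x. x ^ (s + r)) =
      (\<Sum>t=0..r div 2. (-1) ^ t * of_nat ((k + r - t) choose (k + t)) * of_int c ^ (r - 2 * t) *
        (\<Sum>i=1..k. \<Sum>j=1..b i. (-1) ^ i * of_int (a i j) ^ (k + t) *
           of_int (c - a i j) ^ (k + t) * of_int (c - 2 * a i j)))" for r
    unfolding moments mult.assoc[symmetric] by (simp only: minus_mult_minus sign mult_1)
  have "(-1) ^ k * fact (s + l) * hilbert_coefficient I (CARD('x) - s) l =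
      (\<Sum>r=0..l. (-1) ^ (l - r) * of_nat (nu s l (l - r)) * (- ((-1) ^ k) * L (\<lambda>x. x ^ (s + r))))"
    unfolding mult.assoc main n_def[symmetric] by (simp add: sum_distrib_left sum_negf mult_ac)
  then show ?thesis
    unfolding moment .
qed

end
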